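(* Let $N\ge 1$ be an integer, $1<p<p_B$ and $q=\frac{2p}{p+1}$. Then there exists $\varepsilon_0=\varepsilon_0(N,p)>0$ such that for any $M\in(0,\varepsilon_0)$, every nonnegative solution $u$ of $$u_t-\Delta u=u^p+M|\nabla u|^q\quad\text{in }\mathbb{R}^N\times\mathbb{R}$$ is $u\equiv 0$.
   Context: The exponent $p_B$ is defined by $p_B:=\frac{N(N+2)}{(N-1)^2}$ if $N>1$ and $p_B:=\infty$ if $N=1$. The operators $\nabla$ and $\Delta$ act only on the spatial variable $x$. A solution is a classical solution, i.e. it belongs to $C^{2,1}(\mathbb{R}^N\times\mathbb{R})$ ($C^2$ in $x$, $C^1$ in $t$). *)

theory Defs
  imports "HOL-Analysis.Analysis"
begin

definition p_B :: "nat \<Rightarrow> ereal" where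
  "p_B N = (if N > 1 then ereal (real N * (real N + 2) / (real N - 1)\<^sup>2) else \<infinity>)"

definition has_partial :: "'n::finite \<Rightarrow> (real^'n \<Rightarrow> real) \<Rightarrow> real^'n \<Rightarrow> bool" where
  "has_partial i f x \<longleftrightarrow> (\<lambda>s. f (x + s *\<^sub>R axis i 1)) field_differentiable at 0"

definition partial :: "'n::finite \<Rightarrow> (real^'n \<Rightarrow> real) \<Rightarrow> real^'n \<Rightarrow> real" where
  "partial i f x = deriv (\<lambda>s. f (x + s *\<^sub>R axis i 1)) 0"

definition grad :: "(real^'n::finite \<Rightarrow> real) \<Rightarrow> real^'n \<Rightarrow> real^'n" where
  "grad f x = (\<chi> i. partial i f x)"

definition laplacian :: "(real^'n::finite \<Rightarrow> real) \<Rightarrow> real^'n \<Rightarrow> real" where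
  "laplacian f x = (\<Sum>i\<in>UNIV. partial i (partial i f) x)"

text \<open>The class \<open>C\<^sup>2\<^sup>,\<^sup>1(\<real>\<^sup>N \<times> \<real>)\<close>: \<open>u\<close>, its spatial partial derivatives up to order two and
  its time derivative exist everywhere and are jointly continuous in \<open>(x, t)\<close>. No mixed
  space-time derivatives are required. Existence is stated separately because \<open>deriv\<close> is total.\<close>

definition C21 :: "(real^'n::finite \<Rightarrow> real \<Rightarrow> real) \<Rightarrow> bool" where
  "C21 u \<longleftrightarrow>
     continuous_on UNIV (\<lambda>(x, t). u x t) \<and>
     (\<forall>x t. u x field_differentiable at t) \<and>
     continuous_on UNIV (\<lambda>(x, t). deriv (u x) t) \<and>
     (\<forall>i. (\<forall>x t. has_partial i (\<lambda>y. u y t) x) \<and>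
          continuous_on UNIV (\<lambda>(x, t). partial i (\<lambda>y. u y t) x)) \<and>
     (\<forall>i j. (\<forall>x t. has_partial j (partial i (\<lambda>y. u y t)) x) \<and>
          continuous_on UNIV (\<lambda>(x, t). partial j (partial i (\<lambda>y. u y t)) x))"

text \<open>Classical nonnegative solutions of \<open>u\<^sub>t - \<Delta>u = u\<^sup>p + M |\<nabla>u|\<^sup>q\<close> on all of
  \<open>\<real>\<^sup>N \<times> \<real>\<close>. Since \<open>0 powr a = 0\<close>, \<open>powr\<close> is the usual power of a nonnegative base for
  positive exponents.\<close>

definition nonneg_solution ::
  "real \<Rightarrow> real \<Rightarrow> real \<Rightarrow> (real^'n::finite \<Rightarrow> real \<Rightarrow> real) \<Rightarrow> bool" where
  "nonneg_solution p q M u \<longleftrightarrow>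
     C21 u \<and> (\<forall>x t. 0 \<le> u x t) \<and>
     (\<forall>x t. deriv (u x) t - laplacian (\<lambda>y. u y t) x
              = u x t powr p + M * norm (grad (\<lambda>y. u y t) x) powr q)"

end

theory Submission
  imports Defs
begin

text \<open>The proof is a Bochner-type integral estimate in the style of Bidaut-Veron. For \<open>v > 0\<close>, a cutoff \<open>\<phi>\<close>
  and \<open>\<kappa> > 0\<close>, integrate \<open>\<phi> |D\<^sup>2v - \<kappa> v\<^sup>-\<^sup>1 \<nabla>v \<otimes> \<nabla>v|\<^sup>2 \<ge> \<phi> (\<Delta>v - \<kappa> v\<^sup>-\<^sup>1 |\<nabla>v|\<^sup>2)\<^sup>2 / N\<close>
  and substitute the equation. The coefficients of \<open>\<integral> \<phi> v\<^sup>-\<^sup>2 |\<nabla>v|\<^sup>4\<close> and \<open>\<integral> \<phi> v\<^sup>p\<^sup>-\<^sup>1 |\<nabla>v|\<^sup>2\<close>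
  are positive as soon as \<open>(N - 1) p / (N + 2) < \<kappa> < N / (N - 1)\<close>, and such \<open>\<kappa>\<close> exists exactly for \<open>p < p\<^sub>B\<close>.
  The gradient term is critical: since \<open>q = 2p / (p + 1)\<close>, Young's inequality gives
  \<open>|\<nabla>v|\<^sup>2\<^sup>q \<le> v\<^sup>-\<^sup>2 |\<nabla>v|\<^sup>4 + v\<^sup>2\<^sup>p\<close>, so it is absorbed when \<open>M\<close> is small. What remains is
  \<open>\<integral> \<phi> u\<^sup>2\<^sup>p \<le> C R\<^sup>s\<close> with \<open>s = N + 2 - 4p / (p - 1) < 0\<close> for a cutoff of the parabolic cylinder of size \<open>R\<close>.
  Third and mixed space-time derivatives, which need not exist, are avoided by integrating difference
  quotients, using only the translation invariance of Lebesgue measure.\<close>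

section \<open>Directional derivatives and integration by parts\<close>

text \<open>The Bochner inequality bounds the gradient terms only through the Laplacian
  \<open>L\<close>, and by the equation \<open>L\<close> contains the time derivative
  \<open>V\<close>, which it does not control. What closes the estimate is that
  \<open>L * V\<close>, \<open>w * V\<close> and \<open>w * L + p * w * a\<close>, where
  \<open>w = v powr p\<close> and \<open>a = |\<nabla>v|^2 / v\<close>, are total derivatives up to
  cutoff terms. Multiplying the equation by \<open>V\<close> thus makes the integral of
  \<open>V^2\<close> an absorbable error, and multiplying it by \<open>w\<close> bounds that of
  \<open>w^2\<close> by \<open>p\<close> times that of \<open>a * w\<close>. The product
  \<open>a * w\<close> has coefficient \<open>\<mu> - \<nu> * p\<close> in the Bochner inequality,
  which is where the lower bound on \<kappa> enters. Since total derivatives have integral exactly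
  zero, they are carried along with arbitrary coefficients: the whole absorption is an inequality
  between real numbers at one point, and integration happens only once. The exponent
  \<open>4p / (p - 1)\<close> comes from the cutoff terms: \<open>r^2 * a * v\<close> costs
  \<open>v^2 * r^4\<close> for an inverse length \<open>r\<close>, and splitting off
  \<open>v^(2p)\<close> by Young's inequality leaves this power of \<open>r\<close>. The cylinder
  has volume of order \<open>R^(N + 2)\<close>, whence \<open>s\<close>.\<close>

definition has_dir_deriv :: "'a::real_normed_vector \<Rightarrow> ('a \<Rightarrow> real) \<Rightarrow> ('a \<Rightarrow> real) \<Rightarrow> bool" where
  "has_dir_deriv d f f' \<longleftrightarrow> (\<forall>z. ((\<lambda>s. f (z + s *\<^sub>R d)) has_real_derivative f' z) (at 0))"

lemma has_dir_derivD:
  assumes "has_dir_deriv d f f'"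
  shows "((\<lambda>s. f (z + s *\<^sub>R d)) has_real_derivative f' (z + s *\<^sub>R d)) (at s)"
proof -
  have "((\<lambda>s'. f ((z + s *\<^sub>R d) + s' *\<^sub>R d)) has_real_derivative f' (z + s *\<^sub>R d)) (at 0)"
    using assms unfolding has_dir_deriv_def by blast
  then show ?thesis
    using DERIV_shift[of "\<lambda>s. f (z + s *\<^sub>R d)" "f' (z + s *\<^sub>R d)" 0 s]
    by (simp add: algebra_simps)
qed

lemma has_dir_deriv_const: "has_dir_deriv d (\<lambda>_. c) (\<lambda>_. 0)"
  by (simp add: has_dir_deriv_def)

lemma has_dir_deriv_add:
  assumes "has_dir_deriv d f f'" "has_dir_deriv d g g'"
  shows "has_dir_deriv d (\<lambda>z. f z + g z) (\<lambda>z. f' z + g' z)"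
  using assms unfolding has_dir_deriv_def by (auto intro: DERIV_add)

lemma has_dir_deriv_diff:
  assumes "has_dir_deriv d f f'" "has_dir_deriv d g g'"
  shows "has_dir_deriv d (\<lambda>z. f z - g z) (\<lambda>z. f' z - g' z)"
  using assms unfolding has_dir_deriv_def by (auto intro: DERIV_diff)

lemma has_dir_deriv_mult:
  assumes "has_dir_deriv d f f'" "has_dir_deriv d g g'"
  shows "has_dir_deriv d (\<lambda>z. f z * g z) (\<lambda>z. f' z * g z + f z * g' z)"
  unfolding has_dir_deriv_def
proof
  fix z
  have "((\<lambda>s. f (z + s *\<^sub>R d) * g (z + s *\<^sub>R d)) has_real_derivative
      f' z * g (z + 0 *\<^sub>R d) + g' z * f (z + 0 *\<^sub>R d)) (at 0)"
    using assms unfolding has_dir_deriv_def by (intro DERIV_mult) auto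
  then show "((\<lambda>s. f (z + s *\<^sub>R d) * g (z + s *\<^sub>R d)) has_real_derivative
      f' z * g z + f z * g' z) (at 0)"
    by (simp add: algebra_simps)
qed

lemma has_dir_deriv_cmult:
  assumes "has_dir_deriv d f f'"
  shows "has_dir_deriv d (\<lambda>z. c * f z) (\<lambda>z. c * f' z)"
  using has_dir_deriv_mult[OF has_dir_deriv_const[of d c] assms] by simp

lemma has_dir_deriv_chain:
  assumes "has_dir_deriv d f f'" "\<And>z. (F has_real_derivative F' z) (at (f z))"
  shows "has_dir_deriv d (\<lambda>z. F (f z)) (\<lambda>z. F' z * f' z)"
  unfolding has_dir_deriv_def
proof
  fix z
  show "((\<lambda>s. F (f (z + s *\<^sub>R d))) has_real_derivative F' z * f' z) (at 0)"
    using assms unfolding has_dir_deriv_def by (intro DERIV_chain2[where g = "\<lambda>s. f (z + s *\<^sub>R d)"]) auto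
qed

lemma has_dir_deriv_translate:
  assumes "has_dir_deriv d f f'"
  shows "has_dir_deriv d (\<lambda>z. f (z + c)) (\<lambda>z. f' (z + c))"
  unfolding has_dir_deriv_def
proof
  fix z
  have "((\<lambda>s. f ((z + c) + s *\<^sub>R d)) has_real_derivative f' (z + c)) (at 0)"
    using assms unfolding has_dir_deriv_def by blast
  then show "((\<lambda>s. f (z + s *\<^sub>R d + c)) has_real_derivative f' (z + c)) (at 0)"
    by (simp add: algebra_simps)
qed

lemma has_dir_deriv_mvt:
  assumes "has_dir_deriv d f f'" "h \<noteq> 0"
  obtains s where "\<bar>s\<bar> \<le> \<bar>h\<bar>" "f (z + h *\<^sub>R d) - f z = h * f' (z + s *\<^sub>R d)"
proof (cases "h > 0")
  case True
  have "\<exists>s>0. s < h \<and> f (z + h *\<^sub>R d) - f (z + 0 *\<^sub>R d) = (h - 0) * f' (z + s *\<^sub>R d)"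
    by (rule MVT2[OF True]) (use has_dir_derivD[OF assms(1)] in auto)
  then show ?thesis using that by force
next
  case False
  with assms have *: "h < 0" by simp
  have "\<exists>s>h. s < 0 \<and> f (z + 0 *\<^sub>R d) - f (z + h *\<^sub>R d) = (0 - h) * f' (z + s *\<^sub>R d)"
    by (rule MVT2[OF *]) (use has_dir_derivD[OF assms(1)] in auto)
  then obtain s where "s > h" "s < 0" "f z - f (z + h *\<^sub>R d) = - h * f' (z + s *\<^sub>R d)" by auto
  then show ?thesis using that[of s] by (auto simp: algebra_simps)
qed

text \<open>Schwarz's theorem along two directions: the second difference of \<open>f\<close> over
  the parallelogram with sides \<open>h * d\<close> and \<open>h * e\<close> is symmetric in the
  directions, and it equals \<open>h^2\<close> times a value of \<open>fde\<close> near
  \<open>z\<close> as well as \<open>h^2\<close> times a value of \<open>fed\<close> near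
  \<open>z\<close>.\<close>

lemma mixed_dir_derivs_eq:
  assumes "has_dir_deriv d f fd" "has_dir_deriv e fd fde"
    and "has_dir_deriv e f fe" "has_dir_deriv d fe fed"
    and "continuous_on UNIV fde" "continuous_on UNIV fed"
  shows "fde z = fed z"
proof -
  \<comment> \<open>Stated for arbitrary directions so that it serves both orders. The mean value
    theorem is applied to the increment of \<open>f\<close> in direction \<open>e\<close>, then to
    \<open>fd\<close> along \<open>e\<close>.\<close>
  have second: "\<exists>p. dist p z \<le> h * (norm d + norm e) \<and>
      (f (z + h *\<^sub>R d + h *\<^sub>R e) - f (z + h *\<^sub>R d)) - (f (z + h *\<^sub>R e) - f z) = h * (h * F p)"
    if D: "has_dir_deriv d f fd" "has_dir_deriv e fd F" and h: "h > 0" for d e fd F h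
  proof -
    have "has_dir_deriv d (\<lambda>x. f (x + h *\<^sub>R e) - f x) (\<lambda>x. fd (x + h *\<^sub>R e) - fd x)"
      by (intro has_dir_deriv_diff has_dir_deriv_translate D)
    then obtain s where s: "\<bar>s\<bar> \<le> \<bar>h\<bar>" "(f (z + h *\<^sub>R d + h *\<^sub>R e) - f (z + h *\<^sub>R d)) - (f (z + h *\<^sub>R e) - f z)
        = h * (fd (z + s *\<^sub>R d + h *\<^sub>R e) - fd (z + s *\<^sub>R d))"
      using h by (elim has_dir_deriv_mvt[where h = h and z = z]) auto
    obtain t where t: "\<bar>t\<bar> \<le> \<bar>h\<bar>" "fd (z + s *\<^sub>R d + h *\<^sub>R e) - fd (z + s *\<^sub>R d) = h * F (z + s *\<^sub>R d + t *\<^sub>R e)"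
      using h D(2) by (elim has_dir_deriv_mvt[where h = h and z = "z + s *\<^sub>R d"]) auto
    have "dist (z + s *\<^sub>R d + t *\<^sub>R e) z = norm (s *\<^sub>R d + t *\<^sub>R e)"
      by (simp add: dist_norm algebra_simps)
    also have "\<dots> \<le> \<bar>s\<bar> * norm d + \<bar>t\<bar> * norm e" using norm_triangle_ineq[of "s *\<^sub>R d" "t *\<^sub>R e"] by simp
    also have "\<dots> \<le> h * norm d + h * norm e"
      using s(1) t(1) h by (intro add_mono mult_right_mono) auto
    finally show ?thesis using s(2) t(2) h by (intro exI[of _ "z + s *\<^sub>R d + t *\<^sub>R e"]) (auto simp: algebra_simps)
  qed
  have "\<bar>fde z - fed z\<bar> \<le> \<epsilon>" if "\<epsilon> > 0" for \<epsilon>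
  proof -
    have "\<epsilon> / 2 > 0" using that by simp
    then obtain \<delta>1 where d1: "\<delta>1 > 0" "\<And>p. dist p z < \<delta>1 \<Longrightarrow> dist (fde p) (fde z) < \<epsilon> / 2"
      using assms(5) unfolding continuous_on_iff by (metis UNIV_I)
    obtain \<delta>2 where d2: "\<delta>2 > 0" "\<And>p. dist p z < \<delta>2 \<Longrightarrow> dist (fed p) (fed z) < \<epsilon> / 2"
      using assms(6) \<open>\<epsilon> / 2 > 0\<close> unfolding continuous_on_iff by (metis UNIV_I)
    define \<delta> where "\<delta> = min \<delta>1 \<delta>2"
    define h where "h = \<delta> / (norm d + norm e + 1)"
    have K: "norm d + norm e + 1 > 0" by (simp add: add_nonneg_pos)
    have "\<delta> > 0" using d1 d2 by (simp add: \<delta>_def)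
    then have h: "h > 0" "h * (norm d + norm e) < \<delta>"
      using K by (auto simp: h_def divide_simps)
    obtain p where p: "dist p z < \<delta>"
      "(f (z + h *\<^sub>R d + h *\<^sub>R e) - f (z + h *\<^sub>R d)) - (f (z + h *\<^sub>R e) - f z) = h * (h * fde p)"
      using second[OF assms(1,2) h(1)] h(2) by force
    obtain p' where p': "dist p' z < \<delta>"
      "(f (z + h *\<^sub>R e + h *\<^sub>R d) - f (z + h *\<^sub>R e)) - (f (z + h *\<^sub>R d) - f z) = h * (h * fed p')"
      using second[OF assms(3,4) h(1)] h(2) by (force simp: add.commute)
    have "h * (h * fde p) = h * (h * fed p')"
      unfolding p(2)[symmetric] p'(2)[symmetric] by (simp add: add_ac)
    then have "fde p = fed p'" using h(1) by simp
    moreover have "dist (fde p) (fde z) < \<epsilon> / 2" "dist (fed p') (fed z) < \<epsilon> / 2"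
      using d1(2) d2(2) p(1) p'(1) by (auto simp: \<delta>_def)
    ultimately show ?thesis unfolding dist_real_def by linarith
  qed
  then show ?thesis
    by (metis abs_le_zero_iff eq_iff_diff_eq_0 field_le_epsilon add_0)
qed

section \<open>Integration by parts through difference quotients\<close>

lemma integrable_bounded_support:
  fixes f :: "'a::euclidean_space \<Rightarrow> real"
  assumes "continuous_on UNIV f" "\<And>z. r < norm z \<Longrightarrow> f z = 0"
  shows "integrable lborel f"
proof -
  have "integrable lborel (\<lambda>x. indicator (cball 0 r) x *\<^sub>R f x)"
    by (rule borel_integrable_compact) (auto intro: continuous_on_subset[OF assms(1)])
  moreover have "(\<lambda>x. indicator (cball 0 r) x *\<^sub>R f x) = f"
    using assms(2) by (intro ext) (auto simp: indicator_def not_le)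
  ultimately show ?thesis by simp
qed

lemma continuous_bounded_on_ball:
  fixes G :: "'a::euclidean_space \<Rightarrow> real"
  assumes "continuous_on UNIV G"
  obtains B where "\<And>z. norm z \<le> s \<Longrightarrow> \<bar>G z\<bar> \<le> B"
proof -
  have "bounded (G ` cball 0 s)"
    by (intro compact_imp_bounded compact_continuous_image continuous_on_subset[OF assms]) auto
  then obtain B where "\<And>y. y \<in> G ` cball 0 s \<Longrightarrow> norm y \<le> B"
    unfolding bounded_iff by blast
  then show ?thesis using that[of B] by simp
qed

lemma integral_lborel_translate:
  fixes f :: "'a::euclidean_space \<Rightarrow> real"
  assumes "continuous_on UNIV f"
  shows "(\<integral>z. f (z + c) \<partial>lborel) = (\<integral>z. f z \<partial>lborel)"
proof -
  have "(\<integral>z. f z \<partial>lborel) = (\<integral>z. f z \<partial>(distr lborel borel ((+) c)))"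
    by (simp add: lborel_distr_plus)
  also have "\<dots> = (\<integral>z. f (c + z) \<partial>lborel)"
    using assms by (subst integral_distr) (auto intro: borel_measurable_continuous_onI)
  finally show ?thesis by (simp add: add.commute)
qed

lemma continuous_on_translate:
  fixes f :: "'a::real_normed_vector \<Rightarrow> real"
  assumes "continuous_on UNIV f"
  shows "continuous_on UNIV (\<lambda>z. f (z + c))"
  by (rule continuous_on_compose2[OF assms]) (auto intro: continuous_intros)

text \<open>Dominated convergence, with the mean value theorem bounding the quotient by the maximum
  of \<open>f'\<close> on a larger ball. The vanishing condition concerns the product of weight and
  increment because in the applications either of the two may carry the compact support.\<close>

lemma tendsto_integral_diff_quotient:
  fixes f f' :: "'a::euclidean_space \<Rightarrow> real"
  assumes D: "has_dir_deriv d f f'" and cf: "continuous_on UNIV f" and cf': "continuous_on UNIV f'"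
    and h: "h \<longlonglongrightarrow> 0" "\<And>n. h n \<noteq> 0" "\<And>n. \<bar>h n\<bar> \<le> 1"
    and cG: "\<And>n. continuous_on UNIV (G n)" and G: "\<And>z. (\<lambda>n. G n z) \<longlonglongrightarrow> G0 z"
    and bound: "\<And>n z. norm z \<le> r \<Longrightarrow> \<bar>G n z\<bar> \<le> B"
    and supp: "\<And>n z. r < norm z \<Longrightarrow> G n z * (f (z + h n *\<^sub>R d) - f z) = 0"
  shows "(\<lambda>n. \<integral>z. G n z * ((f (z + h n *\<^sub>R d) - f z) / h n) \<partial>lborel) \<longlonglongrightarrow> (\<integral>z. G0 z * f' z \<partial>lborel)"
proof -
  obtain B' where B': "\<And>z. norm z \<le> r + norm d \<Longrightarrow> \<bar>f' z\<bar> \<le> B'"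
    using continuous_bounded_on_ball[OF cf'] by blast
  have meas [measurable]: "f \<in> borel_measurable borel" "f' \<in> borel_measurable borel" "\<And>n. G n \<in> borel_measurable borel"
    using cf cf' cG by (auto intro: borel_measurable_continuous_onI)
  have [measurable]: "G0 \<in> borel_measurable borel"
    by (rule borel_measurable_LIMSEQ_real[OF G]) auto
  have lim: "(\<lambda>n. G n z * ((f (z + h n *\<^sub>R d) - f z) / h n)) \<longlonglongrightarrow> G0 z * f' z" for z
  proof (rule tendsto_mult[OF G])
    have "((\<lambda>s. (f (z + (0 + s) *\<^sub>R d) - f (z + 0 *\<^sub>R d)) / s) \<longlongrightarrow> f' z) (at 0)"
      using D unfolding has_dir_deriv_def DERIV_def by auto
    then show "(\<lambda>n. (f (z + h n *\<^sub>R d) - f z) / h n) \<longlonglongrightarrow> f' z"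
      using filterlim_compose[of "\<lambda>s. (f (z + s *\<^sub>R d) - f z) / s" _ "at 0" h] h
      by (auto simp: filterlim_at eventually_sequentially)
  qed
  have dom: "norm (G n z * ((f (z + h n *\<^sub>R d) - f z) / h n)) \<le> indicator (cball 0 r) z * (\<bar>B\<bar> * \<bar>B'\<bar>)" for n z
  proof (cases "norm z \<le> r")
    case True
    obtain s where s: "\<bar>s\<bar> \<le> \<bar>h n\<bar>" "f (z + h n *\<^sub>R d) - f z = h n * f' (z + s *\<^sub>R d)"
      using has_dir_deriv_mvt[OF D h(2)] by blast
    have "\<bar>s\<bar> \<le> 1" using s h(3) order_trans by blast
    have "norm (z + s *\<^sub>R d) \<le> norm z + norm (s *\<^sub>R d)" by (rule norm_triangle_ineq)
    also have "\<dots> \<le> r + norm d" using True \<open>\<bar>s\<bar> \<le> 1\<close> mult_right_mono[of "\<bar>s\<bar>" 1 "norm d"] by simp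
    finally have "\<bar>f' (z + s *\<^sub>R d)\<bar> \<le> B'" by (rule B')
    moreover have "\<bar>G n z\<bar> \<le> B" using True bound by blast
    ultimately have "\<bar>G n z\<bar> * \<bar>f' (z + s *\<^sub>R d)\<bar> \<le> \<bar>B\<bar> * \<bar>B'\<bar>" by (intro mult_mono) auto
    then show ?thesis using True s(2) h(2) by (simp add: abs_mult)
  next
    case False
    then have "G n z * (f (z + h n *\<^sub>R d) - f z) = 0" using supp by simp
    then show ?thesis by (auto simp: zero_le_mult_iff)
  qed
  have int: "integrable lborel (\<lambda>z::'a. indicator (cball 0 r) z * (\<bar>B\<bar> * \<bar>B'\<bar>))"
    by (intro integrable_mult_left integrable_real_indicator emeasure_compact_finite)
       (auto simp: emeasure_lborel_cball_finite)
  show ?thesis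
    by (rule integral_dominated_convergence[OF _ _ int]) (use lim dom in auto)
qed

text \<open>Besides being a difference step, this sequence later serves as the positive shift added
  to the solution.\<close>

definition hstep :: "nat \<Rightarrow> real" where "hstep n = inverse (real (Suc n))"

lemma hstep: "hstep \<longlonglongrightarrow> 0" "hstep n > 0" "hstep n \<noteq> 0" "\<bar>hstep n\<bar> \<le> 1"
  using LIMSEQ_inverse_real_of_nat by (auto simp: hstep_def[abs_def] divide_simps)

lemma norm_shift_gt:
  fixes z d :: "'a::real_normed_vector"
  assumes "r + norm d < norm z" "\<bar>s\<bar> \<le> 1" shows "r < norm (z + s *\<^sub>R d)"
proof -
  have "norm z \<le> norm (z + s *\<^sub>R d) + norm (s *\<^sub>R d)"
    using norm_triangle_ineq4[of "z + s *\<^sub>R d" "s *\<^sub>R d"] by simp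
  moreover have "norm (s *\<^sub>R d) \<le> norm d" using assms(2) mult_right_mono[of "\<bar>s\<bar>" 1 "norm d"] by simp
  ultimately show ?thesis using assms(1) by linarith
qed

text \<open>By translation invariance every difference quotient of \<open>g\<close> has integral
  zero, and \<open>g'\<close> is their limit; no iterated integrals occur.\<close>

lemma integral_dir_deriv_eq_0:
  fixes g g' :: "'a::euclidean_space \<Rightarrow> real"
  assumes D: "has_dir_deriv d g g'" and c: "continuous_on UNIV g" "continuous_on UNIV g'"
    and supp: "\<And>z. r < norm z \<Longrightarrow> g z = 0"
  shows "(\<integral>z. g' z \<partial>lborel) = 0"
proof -
  have "(\<lambda>n. \<integral>z. 1 * ((g (z + hstep n *\<^sub>R d) - g z) / hstep n) \<partial>lborel) \<longlonglongrightarrow> (\<integral>z. 1 * g' z \<partial>lborel)"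
  proof (rule tendsto_integral_diff_quotient[OF D c hstep(1,3,4), where G = "\<lambda>_ _. 1" and B = 1 and r = "r + norm d"])
    fix n and z :: 'a assume z: "r + norm d < norm z"
    then have "r < norm z" using norm_ge_zero[of d] by linarith
    then show "1 * (g (z + hstep n *\<^sub>R d) - g z) = 0"
      using supp norm_shift_gt[OF z hstep(4)] by simp
  qed auto
  moreover have "(\<integral>z. 1 * ((g (z + hstep n *\<^sub>R d) - g z) / hstep n) \<partial>lborel) = 0" for n
  proof -
    have "integrable lborel g" by (rule integrable_bounded_support[OF c(1) supp])
    moreover have "integrable lborel (\<lambda>z. g (z + hstep n *\<^sub>R d))"
      by (rule integrable_bounded_support[OF continuous_on_translate[OF c(1)], of "r + norm d"])
         (use supp norm_shift_gt hstep(4) in blast)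
    ultimately show ?thesis by (simp add: integral_lborel_translate[OF c(1)])
  qed
  ultimately have "(\<lambda>n. 0) \<longlonglongrightarrow> (\<integral>z. g' z \<partial>lborel)" by (simp only: mult_1)
  then show ?thesis by (simp add: LIMSEQ_const_iff)
qed

text \<open>Discrete integration by parts: translating by \<open>c\<close> moves the increment from
  \<open>w\<close> to \<open>K\<close> with the step reversed. The two minus signs keep the result
  in the form of a difference quotient with step \<open>- s\<close>.\<close>

lemma integral_mult_backward_diff:
  fixes K w :: "'a::euclidean_space \<Rightarrow> real"
  assumes c: "continuous_on UNIV K" "continuous_on UNIV w" and supp: "\<And>z. r < norm z \<Longrightarrow> K z = 0"
  shows "(\<integral>z. K z * ((w (z + c) - w z) / s) \<partial>lborel) = - (\<integral>z. w z * ((K (z + (- c)) - K z) / - s) \<partial>lborel)"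
proof -
  have int: "integrable lborel (\<lambda>z. K z * w (z + c))" "integrable lborel (\<lambda>z. K z * w z)"
    by (rule integrable_bounded_support[of _ r]; use supp in \<open>auto intro!: continuous_intros c continuous_on_translate\<close>)+
  have int3: "integrable lborel (\<lambda>z. K (z - c) * w z)"
  proof (rule integrable_bounded_support[of _ "r + norm c"])
    show "continuous_on UNIV (\<lambda>z. K (z - c) * w z)"
      using continuous_on_translate[OF c(1), of "- c"] by (auto intro!: continuous_intros c)
    show "K (z - c) * w z = 0" if "r + norm c < norm z" for z
      using norm_shift_gt[OF that, of "-1"] supp by simp
  qed
  have "(\<integral>z. K z * ((w (z + c) - w z) / s) \<partial>lborel) = (\<integral>z. (K z * w (z + c) - K z * w z) / s \<partial>lborel)"
    by (simp add: algebra_simps diff_divide_distrib)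
  also have "\<dots> = ((\<integral>z. K z * w (z + c) \<partial>lborel) - (\<integral>z. K z * w z \<partial>lborel)) / s"
    using int by simp
  also have "(\<integral>z. K z * w (z + c) \<partial>lborel) = (\<integral>z. K (z - c) * w z \<partial>lborel)"
    using integral_lborel_translate[of "\<lambda>z. K (z - c) * w z" c]
      continuous_on_mult[OF continuous_on_translate[OF c(1), of "- c"] c(2)] by simp
  also have "((\<integral>z. K (z - c) * w z \<partial>lborel) - (\<integral>z. K z * w z \<partial>lborel)) / s = (\<integral>z. (K (z - c) * w z - K z * w z) / s \<partial>lborel)"
    using int int3 by simp
  also have "\<dots> = (\<integral>z. - (w z * ((K (z + (- c)) - K z) / - s)) \<partial>lborel)"
    by (simp add: algebra_simps diff_divide_distrib)
  finally show ?thesis by simp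
qed

text \<open>Formally the integrand is the \<open>d\<close>-derivative of \<open>p * wd * wee\<close>
  minus the \<open>e\<close>-derivative of \<open>p * wd * wde\<close>, where the third derivatives
  cancel. To make this rigorous, \<open>wee\<close> is replaced by the difference quotient
  \<open>Q n\<close> of \<open>we\<close>, which can be differentiated along
  \<open>d\<close>.\<close>

lemma integral_hessian_identity:
  fixes p :: "'a::euclidean_space \<Rightarrow> real"
  assumes D: "has_dir_deriv d p pd" "has_dir_deriv e p pe" "has_dir_deriv d wd wdd"
      "has_dir_deriv e wd wde" "has_dir_deriv e we wee" "has_dir_deriv d we wde"
    and c: "continuous_on UNIV p" "continuous_on UNIV pd" "continuous_on UNIV pe"
      "continuous_on UNIV wd" "continuous_on UNIV wdd" "continuous_on UNIV wde"
      "continuous_on UNIV we" "continuous_on UNIV wee"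
    and supp: "\<And>z. r < norm z \<Longrightarrow> p z = 0" "\<And>z. r < norm z \<Longrightarrow> pd z = 0" "\<And>z. r < norm z \<Longrightarrow> pe z = 0"
  shows "(\<integral>z. p z * (wdd z * wee z - (wde z)\<^sup>2) + pd z * wd z * wee z - pe z * wd z * wde z \<partial>lborel) = 0"
proof -
  define F where "F z = p z * wdd z + pd z * wd z" for z
  define K where "K z = p z * wd z" for z
  define Q where "Q n z = (we (z + hstep n *\<^sub>R e) - we z) / hstep n" for n z
  define S where "S n z = (wde (z + hstep n *\<^sub>R e) - wde z) / hstep n" for n z
  note c' = c continuous_on_translate[OF c(6)] continuous_on_translate[OF c(7)]
  have cF: "continuous_on UNIV F" and cK: "continuous_on UNIV K"
    and cK': "continuous_on UNIV (\<lambda>z. pe z * wd z + p z * wde z)"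
    and cQ: "\<And>n. continuous_on UNIV (Q n)" and cS: "\<And>n. continuous_on UNIV (S n)"
    unfolding F_def[abs_def] K_def[abs_def] Q_def[abs_def] S_def[abs_def] using hstep(3)
    by (auto intro!: continuous_intros c')
  have F0: "r < norm z \<Longrightarrow> F z = 0" and K0: "r < norm z \<Longrightarrow> K z = 0" for z
    by (auto simp: F_def K_def supp)
  have DK: "has_dir_deriv e K (\<lambda>z. pe z * wd z + p z * wde z)"
    unfolding K_def[abs_def] by (intro has_dir_deriv_mult D)
  have 1: "(\<lambda>n. \<integral>z. F z * Q n z \<partial>lborel) \<longlonglongrightarrow> (\<integral>z. F z * wee z \<partial>lborel)"
  proof -
    obtain B where B: "\<And>z. norm z \<le> r \<Longrightarrow> \<bar>F z\<bar> \<le> B"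
      using continuous_bounded_on_ball[OF cF] by blast
    then show ?thesis unfolding Q_def
      by (intro tendsto_integral_diff_quotient[OF D(5) c(7,8) hstep(1,3,4), where r = r and B = B]) (auto intro: cF F0 B)
  qed
  \<comment> \<open>Integration by parts along \<open>d\<close>. The derivative of
    \<open>Q n\<close> is \<open>S n\<close>, the stand-in for a third derivative.\<close>
  have 2: "(\<integral>z. F z * Q n z \<partial>lborel) = - (\<integral>z. K z * S n z \<partial>lborel)" for n
  proof -
    have DQ: "has_dir_deriv d (Q n) (S n)"
      using has_dir_deriv_cmult[OF has_dir_deriv_diff[OF has_dir_deriv_translate[OF D(6)] D(6)], of "inverse (hstep n)"]
      by (simp add: Q_def[abs_def] S_def[abs_def] divide_inverse mult.commute)
    have "(\<integral>z. (pd z * wd z + p z * wdd z) * Q n z + K z * S n z \<partial>lborel) = 0"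
      by (rule integral_dir_deriv_eq_0[where g = "\<lambda>z. K z * Q n z" and d = d and r = r])
         (use K0 in \<open>auto simp: K_def intro!: has_dir_deriv_mult D DQ continuous_intros c cQ cS\<close>)
    moreover have "integrable lborel (\<lambda>z. F z * Q n z)" "integrable lborel (\<lambda>z. K z * S n z)"
      by (rule integrable_bounded_support[of _ r]; use F0 K0 in \<open>auto intro!: continuous_intros cF cQ cK cS\<close>)+
    ultimately show ?thesis by (simp add: F_def add.commute)
  qed
  \<comment> \<open>The quotient is shifted onto \<open>K\<close>, which does have a derivative
    along \<open>e\<close>, so the limit exists.\<close>
  have 3: "(\<integral>z. K z * S n z \<partial>lborel) = - (\<integral>z. wde z * ((K (z + (- hstep n) *\<^sub>R e) - K z) / - hstep n) \<partial>lborel)" for n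
    unfolding S_def using integral_mult_backward_diff[OF cK c(6) K0, where c = "hstep n *\<^sub>R e" and s = "hstep n"] by (simp only: scaleR_minus_left)
  have 4: "(\<lambda>n. \<integral>z. wde z * ((K (z + (- hstep n) *\<^sub>R e) - K z) / - hstep n) \<partial>lborel)
      \<longlonglongrightarrow> (\<integral>z. wde z * (pe z * wd z + p z * wde z) \<partial>lborel)"
  proof -
    obtain B where B: "\<And>z. norm z \<le> r + norm e \<Longrightarrow> \<bar>wde z\<bar> \<le> B"
      using continuous_bounded_on_ball[OF c(6)] by blast
    have h: "(\<lambda>n. - hstep n) \<longlonglongrightarrow> 0" using tendsto_minus[OF hstep(1)] by simp
    show ?thesis
    proof (rule tendsto_integral_diff_quotient[OF DK cK cK' h, where r = "r + norm e" and B = B])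
      fix n and z :: 'a assume z: "r + norm e < norm z"
      then have "r < norm z" using norm_ge_zero[of e] by linarith
      then show "wde z * (K (z + (- hstep n) *\<^sub>R e) - K z) = 0"
        using K0 norm_shift_gt[OF z, of "- hstep n"] hstep(4)[of n] by simp
    qed (use B hstep(3,4) c(6) in auto)
  qed
  have "(\<lambda>n. \<integral>z. F z * Q n z \<partial>lborel) \<longlonglongrightarrow> (\<integral>z. wde z * (pe z * wd z + p z * wde z) \<partial>lborel)"
    using 4 by (simp only: 2 3 minus_minus)
  with 1 have "(\<integral>z. F z * wee z \<partial>lborel) = (\<integral>z. wde z * (pe z * wd z + p z * wde z) \<partial>lborel)"
    by (rule LIMSEQ_unique)
  moreover have "integrable lborel (\<lambda>z. F z * wee z)"
      "integrable lborel (\<lambda>z. wde z * (pe z * wd z + p z * wde z))"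
    by (rule integrable_bounded_support[of _ r]; use F0 supp in \<open>auto intro!: continuous_intros cF c\<close>)+
  ultimately have "(\<integral>z. F z * wee z - wde z * (pe z * wd z + p z * wde z) \<partial>lborel) = 0" by simp
  then show ?thesis by (simp add: F_def algebra_simps power2_eq_square)
qed

text \<open>Formally the integrand is the \<open>d\<close>-derivative of \<open>p * wd * we\<close>
  minus the \<open>e\<close>-derivative of \<open>p * wd^2 / 2\<close>. It is used with
  \<open>d\<close> spatial and \<open>e\<close> the time direction, to test the Laplacian against
  the time derivative. The argument for the Hessian identity does not carry over, since
  \<open>K\<close> now need not be differentiable along \<open>e\<close>.\<close>

lemma integral_energy_identity:
  fixes p :: "'a::euclidean_space \<Rightarrow> real"
  assumes D: "has_dir_deriv d p pd" "has_dir_deriv e p pe" "has_dir_deriv d w wd"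
      "has_dir_deriv d wd wdd" "has_dir_deriv e w we"
    and c: "continuous_on UNIV p" "continuous_on UNIV pd" "continuous_on UNIV pe"
      "continuous_on UNIV w" "continuous_on UNIV wd" "continuous_on UNIV wdd" "continuous_on UNIV we"
    and supp: "\<And>z. r < norm z \<Longrightarrow> p z = 0" "\<And>z. r < norm z \<Longrightarrow> pd z = 0" "\<And>z. r < norm z \<Longrightarrow> pe z = 0"
  shows "(\<integral>z. p z * wdd z * we z + pd z * wd z * we z - pe z * (wd z)\<^sup>2 / 2 \<partial>lborel) = 0"
proof -
  define F where "F z = p z * wdd z + pd z * wd z" for z
  define K where "K z = p z * wd z" for z
  define Q where "Q s z = (w (z + s *\<^sub>R e) - w z) / s" for s z
  define S where "S s z = (wd (z + s *\<^sub>R e) - wd z) / s" for s z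
  note c' = c continuous_on_translate[OF c(4)] continuous_on_translate[OF c(5)]
  have cF: "continuous_on UNIV F" and cK: "continuous_on UNIV K"
    and cQ: "\<And>n. continuous_on UNIV (Q n)" and cS: "\<And>n. continuous_on UNIV (S n)"
    unfolding F_def[abs_def] K_def[abs_def] Q_def[abs_def] S_def[abs_def] divide_inverse
    by (auto intro!: continuous_intros c')
  have F0: "r < norm z \<Longrightarrow> F z = 0" and K0: "r < norm z \<Longrightarrow> K z = 0" for z
    by (auto simp: F_def K_def supp)
  have h': "(\<lambda>n. - hstep n) \<longlonglongrightarrow> 0" using tendsto_minus[OF hstep(1)] by simp
  have 1: "(\<lambda>n. \<integral>z. F z * Q (s n) z \<partial>lborel) \<longlonglongrightarrow> (\<integral>z. F z * we z \<partial>lborel)"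
    if s: "s \<longlonglongrightarrow> 0" "\<And>n. s n \<noteq> 0" "\<And>n. \<bar>s n\<bar> \<le> 1" for s
  proof -
    obtain B where B: "\<And>z. norm z \<le> r \<Longrightarrow> \<bar>F z\<bar> \<le> B"
      using continuous_bounded_on_ball[OF cF] by blast
    then show ?thesis unfolding Q_def
      by (intro tendsto_integral_diff_quotient[OF D(5) c(4,7) s, where r = r and B = B]) (auto intro: cF F0 B)
  qed
  have 2: "(\<integral>z. F z * Q s z \<partial>lborel) = - (\<integral>z. K z * S s z \<partial>lborel)" for s
  proof -
    have DQ: "has_dir_deriv d (Q s) (S s)"
      using has_dir_deriv_cmult[OF has_dir_deriv_diff[OF has_dir_deriv_translate[OF D(3)] D(3)], of "inverse s"]
      by (simp add: Q_def[abs_def] S_def[abs_def] divide_inverse mult.commute)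
    have "(\<integral>z. (pd z * wd z + p z * wdd z) * Q s z + K z * S s z \<partial>lborel) = 0"
      by (rule integral_dir_deriv_eq_0[where g = "\<lambda>z. K z * Q s z" and d = d and r = r])
         (use K0 in \<open>auto simp: K_def intro!: has_dir_deriv_mult D DQ continuous_intros c cQ cS\<close>)
    moreover have "integrable lborel (\<lambda>z. F z * Q s z)" "integrable lborel (\<lambda>z. K z * S s z)"
      by (rule integrable_bounded_support[of _ r]; use F0 K0 in \<open>auto intro!: continuous_intros cF cQ cK cS\<close>)+
    ultimately show ?thesis by (simp add: F_def add.commute)
  qed
  \<comment> \<open>The symmetric difference quotient avoids the derivative of \<open>wd\<close> along \<open>e\<close>, which need not exist.\<close>
  have 3: "(\<integral>z. K z * S s z \<partial>lborel) + (\<integral>z. K z * S (- s) z \<partial>lborel)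
      = - (\<integral>z. wd z * wd (z + s *\<^sub>R e) * ((p (z + s *\<^sub>R e) - p z) / s) \<partial>lborel)" if s: "\<bar>s\<bar> \<le> 1" for s
  proof -
    have ip: "integrable lborel (\<lambda>z. K z * wd (z + t *\<^sub>R e))" for t
      by (rule integrable_bounded_support[of _ r]) (use K0 in \<open>auto intro!: continuous_intros cK c'\<close>)
    have cT: "continuous_on UNIV (\<lambda>z. K (z + s *\<^sub>R e) * wd z)"
      by (auto intro!: continuous_intros continuous_on_translate[OF cK] c)
    have iT: "integrable lborel (\<lambda>z. K (z + s *\<^sub>R e) * wd z)"
      by (rule integrable_bounded_support[OF cT, of "r + norm e"]) (use K0 norm_shift_gt[OF _ s] in auto)
    have "(\<integral>z. K z * S s z \<partial>lborel) + (\<integral>z. K z * S (- s) z \<partial>lborel) = (\<integral>z. K z * S s z + K z * S (- s) z \<partial>lborel)"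
      by (rule Bochner_Integration.integral_add[symmetric];
          rule integrable_bounded_support[of _ r]; use K0 in \<open>auto intro!: continuous_intros cK cS\<close>)
    also have "\<dots> = (\<integral>z. (K z * wd (z + s *\<^sub>R e) - K z * wd (z + (-s) *\<^sub>R e)) / s \<partial>lborel)"
      by (rule Bochner_Integration.integral_cong) (auto simp: S_def algebra_simps diff_divide_distrib)
    also have "\<dots> = ((\<integral>z. K z * wd (z + s *\<^sub>R e) \<partial>lborel) - (\<integral>z. K z * wd (z + (-s) *\<^sub>R e) \<partial>lborel)) / s"
      using ip[of s] ip[of "- s"] by simp
    \<comment> \<open>After this translation both terms contain the product
      \<open>wd z * wd (z + s *\<^sub>R e)\<close>, so the remaining increment falls on
      \<open>p\<close> alone.\<close>
    also have "(\<integral>z. K z * wd (z + (-s) *\<^sub>R e) \<partial>lborel) = (\<integral>z. K (z + s *\<^sub>R e) * wd z \<partial>lborel)"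
      using integral_lborel_translate[of "\<lambda>z. K z * wd (z + (-s) *\<^sub>R e)" "s *\<^sub>R e"]
        continuous_on_mult[OF cK c'(9), of "(-s) *\<^sub>R e"] by simp
    also have "((\<integral>z. K z * wd (z + s *\<^sub>R e) \<partial>lborel) - \<dots>) / s = (\<integral>z. (K z * wd (z + s *\<^sub>R e) - K (z + s *\<^sub>R e) * wd z) / s \<partial>lborel)"
      using ip iT by simp
    also have "\<dots> = (\<integral>z. - (wd z * wd (z + s *\<^sub>R e) * ((p (z + s *\<^sub>R e) - p z) / s)) \<partial>lborel)"
      by (rule Bochner_Integration.integral_cong) (auto simp: K_def algebra_simps diff_divide_distrib)
    finally show ?thesis by simp
  qed
  have 4: "(\<lambda>n. \<integral>z. wd z * wd (z + hstep n *\<^sub>R e) * ((p (z + hstep n *\<^sub>R e) - p z) / hstep n) \<partial>lborel)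
      \<longlonglongrightarrow> (\<integral>z. wd z * wd z * pe z \<partial>lborel)"
  proof -
    obtain B where B: "\<And>z. norm z \<le> r + norm e + norm e \<Longrightarrow> \<bar>wd z\<bar> \<le> B"
      using continuous_bounded_on_ball[OF c(5)] by blast
    show ?thesis
    proof (rule tendsto_integral_diff_quotient[OF D(2) c(1,3) hstep(1,3,4), where r = "r + norm e" and B = "B * B"])
      fix n and z :: 'a
      show "continuous_on UNIV (\<lambda>z. wd z * wd (z + hstep n *\<^sub>R e))" for n
        by (auto intro!: continuous_intros c')
      have "(\<lambda>n. z + hstep n *\<^sub>R e) \<longlonglongrightarrow> z + 0 *\<^sub>R e" by (intro tendsto_intros hstep)
      then have "(\<lambda>n. wd (z + hstep n *\<^sub>R e)) \<longlonglongrightarrow> wd z"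
        using continuous_on_tendsto_compose[OF c(5)] by (auto simp: )
      then show "(\<lambda>n. wd z * wd (z + hstep n *\<^sub>R e)) \<longlonglongrightarrow> wd z * wd z" by (intro tendsto_intros)
      show "\<bar>wd z * wd (z + hstep n *\<^sub>R e)\<bar> \<le> B * B" if z: "norm z \<le> r + norm e"
      proof -
        have "norm (z + hstep n *\<^sub>R e) \<le> norm z + norm (hstep n *\<^sub>R e)" by (rule norm_triangle_ineq)
        moreover have "norm (hstep n *\<^sub>R e) \<le> norm e"
          using hstep(4)[of n] mult_right_mono[of "\<bar>hstep n\<bar>" 1 "norm e"] by simp
        ultimately have "\<bar>wd (z + hstep n *\<^sub>R e)\<bar> \<le> B" "\<bar>wd z\<bar> \<le> B"
          using B z norm_ge_zero[of e] by (smt (verit))+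
        then show ?thesis unfolding abs_mult by (intro mult_mono) auto
      qed
      show "wd z * wd (z + hstep n *\<^sub>R e) * (p (z + hstep n *\<^sub>R e) - p z) = 0" if z: "r + norm e < norm z"
      proof -
        have "p (z + hstep n *\<^sub>R e) = 0" using norm_shift_gt[OF z hstep(4)] by (rule supp(1))
        moreover have "p z = 0" using z norm_ge_zero[of e] by (intro supp(1)) linarith
        ultimately show ?thesis by simp
      qed
    qed
  qed
  \<comment> \<open>Forward and backward quotients of \<open>w\<close> both tend to
    \<open>we\<close>; the resulting factor 2 is the origin of the division by 2 in the
    identity.\<close>
  have "(\<lambda>n. (\<integral>z. F z * Q (hstep n) z \<partial>lborel) + (\<integral>z. F z * Q (- hstep n) z \<partial>lborel))
     \<longlonglongrightarrow> (\<integral>z. F z * we z \<partial>lborel) + (\<integral>z. F z * we z \<partial>lborel)"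
    by (intro tendsto_add 1 hstep h') (use hstep(3,4) in auto)
  moreover have "(\<integral>z. F z * Q (hstep n) z \<partial>lborel) + (\<integral>z. F z * Q (- hstep n) z \<partial>lborel)
     = (\<integral>z. wd z * wd (z + hstep n *\<^sub>R e) * ((p (z + hstep n *\<^sub>R e) - p z) / hstep n) \<partial>lborel)" for n
    using 3[OF hstep(4), of n] 2[of "hstep n"] 2[of "- hstep n"] by linarith
  ultimately have "(\<integral>z. F z * we z \<partial>lborel) + (\<integral>z. F z * we z \<partial>lborel) = (\<integral>z. wd z * wd z * pe z \<partial>lborel)"
    using 4 LIMSEQ_unique by simp
  moreover have i: "integrable lborel (\<lambda>z. F z * we z)" "integrable lborel (\<lambda>z. wd z * wd z * pe z)"
    by (rule integrable_bounded_support[of _ r]; use F0 supp in \<open>auto intro!: continuous_intros cF c\<close>)+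
  ultimately have "(\<integral>z. F z * we z - wd z * wd z * pe z / 2 \<partial>lborel) = 0" by simp
  then show ?thesis by (simp add: F_def algebra_simps power2_eq_square)
qed

section \<open>Pointwise absorption\<close>

lemma mult_le_weighted_squares:
  fixes x y :: real assumes "\<eta> > 0"
  shows "\<bar>x * y\<bar> \<le> \<eta> * x\<^sup>2 + y\<^sup>2 / (4 * \<eta>)"
proof -
  have "0 \<le> (2 * \<eta> * \<bar>x\<bar> - \<bar>y\<bar>)\<^sup>2" by simp
  then have "4 * \<eta> * \<bar>x * y\<bar> \<le> 4 * \<eta> * (\<eta> * x\<^sup>2) + y\<^sup>2"
    by (simp add: power2_diff abs_mult algebra_simps power2_eq_square)
  then have "\<bar>x * y\<bar> \<le> (4 * \<eta> * (\<eta> * x\<^sup>2) + y\<^sup>2) / (4 * \<eta>)"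
    using assms by (simp add: pos_le_divide_eq mult.commute)
  also have "\<dots> = \<eta> * x\<^sup>2 + y\<^sup>2 / (4 * \<eta>)" using assms by (simp add: field_simps)
  finally show ?thesis .
qed

text \<open>If the first term on the right does not already dominate, then
  \<open>v powr (2 * (p - 1)) < r ^ 4 / \<eta>\<close>. This bounds \<open>v^2\<close> by a power of
  \<open>r\<close>, and the exponents add up as
  \<open>4 / (p - 1) + 4 = 4 * p / (p - 1)\<close>.\<close>

lemma young_critical_power:
  fixes p v r \<eta> :: real assumes "1 < p" "0 < v" "0 < r" "0 < \<eta>"
  shows "v\<^sup>2 * r ^ 4 \<le> \<eta> * (v powr p)\<^sup>2 + \<eta> powr (- 1 / (p - 1)) * r powr (4 * p / (p - 1))"
proof (cases "v\<^sup>2 * r ^ 4 \<le> \<eta> * (v powr p)\<^sup>2")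
  case True
  have "0 \<le> \<eta> powr (- 1 / (p - 1)) * r powr (4 * p / (p - 1))" by simp
  then show ?thesis using True by (rule add_increasing2)
next
  case False
  have "(v powr p)\<^sup>2 = v powr (2 * p)" unfolding power2_eq_square mult_2 powr_add ..
  also have "\<dots> = v\<^sup>2 * v powr (2 * (p - 1))"
    using assms powr_add[of v 2 "2 * (p - 1)"] by (simp add: algebra_simps)
  finally have "v\<^sup>2 * (\<eta> * v powr (2 * (p - 1))) < v\<^sup>2 * r ^ 4" using False by (simp add: mult_ac)
  then have *: "\<eta> * v powr (2 * (p - 1)) < r ^ 4" using assms by simp
  then have "v powr (2 * (p - 1)) < r powr 4 / \<eta>"
    using assms by (simp add: pos_less_divide_eq mult.commute)
  then have "(v powr (2 * (p - 1))) powr (1 / (p - 1)) \<le> (r powr 4 / \<eta>) powr (1 / (p - 1))"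
    using assms by (intro powr_mono2) auto
  moreover have "(v powr (2 * (p - 1))) powr (1 / (p - 1)) = v\<^sup>2"
  proof -
    have "2 * (p - 1) * (1 / (p - 1)) = 2" using assms by (simp add: divide_simps)
    then have "(v powr (2 * (p - 1))) powr (1 / (p - 1)) = v powr 2" by (simp only: powr_powr)
    then show ?thesis using assms by simp
  qed
  moreover have "(r powr 4 / \<eta>) powr (1 / (p - 1)) = r powr (4 / (p - 1)) * \<eta> powr (- 1 / (p - 1))"
  proof -
    have "(r powr 4 / \<eta>) powr (1 / (p - 1)) = (r powr 4) powr (1 / (p - 1)) / \<eta> powr (1 / (p - 1))"
      by (rule powr_divide)
    also have "(r powr 4) powr (1 / (p - 1)) = r powr (4 / (p - 1))" by (simp add: powr_powr del: powr_numeral)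
    also have "r powr (4 / (p - 1)) / \<eta> powr (1 / (p - 1)) = r powr (4 / (p - 1)) * \<eta> powr - (1 / (p - 1))"
      by (simp only: powr_minus divide_inverse)
    finally show ?thesis by simp
  qed
  ultimately have "v\<^sup>2 * r ^ 4 \<le> (r powr (4 / (p - 1)) * \<eta> powr (- 1 / (p - 1))) * r ^ 4"
    using assms by (intro mult_right_mono) auto
  also have "\<dots> = \<eta> powr (- 1 / (p - 1)) * (r powr (4 / (p - 1)) * r powr 4)"
    using assms by simp
  also have "r powr (4 / (p - 1)) * r powr 4 = r powr (4 * p / (p - 1))"
    using assms by (subst powr_add[symmetric]) (simp add: field_simps)
  finally show ?thesis using assms by (intro add_increasing) auto
qed

text \<open>Here \<open>a * v\<close> is the squared gradient. The critical value of the exponent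
  makes the left side \<open>a powr (2 * p / (p + 1)) * w powr (2 / (p + 1))\<close> with
  \<open>w = v powr p\<close>: the exponents sum to 2, so both bases may be replaced by the larger
  one.\<close>

lemma gradient_power_bound:
  fixes p a v :: real assumes "1 < p" "0 \<le> a" "0 < v"
  shows "((sqrt (a * v)) powr (2 * p / (p + 1)))\<^sup>2 \<le> a\<^sup>2 + (v powr p)\<^sup>2"
proof (cases "a = 0")
  case False
  define w where "w = v powr p"
  define m where "m = max a w"
  have pos: "a > 0" "w > 0" "m > 0" using assms False by (auto simp: w_def m_def)
  have "((sqrt (a * v)) powr (2 * p / (p + 1)))\<^sup>2 = ((a * v) powr (1/2)) powr (2 * p / (p + 1) * 2)"
    using pos assms by (simp add: powr_half_sqrt powr_powr powr_numeral[symmetric] del: powr_numeral)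
  also have "\<dots> = (a * v) powr (2 * p / (p + 1))" by (simp add: powr_powr)
  also have "\<dots> = a powr (2 * p / (p + 1)) * w powr (2 / (p + 1))"
    using pos assms by (simp add: powr_mult w_def powr_powr mult.commute)
  also have "\<dots> \<le> m powr (2 * p / (p + 1)) * m powr (2 / (p + 1))"
    using pos assms by (intro mult_mono powr_mono2) (auto simp: m_def)
  also have "\<dots> = m powr (2 * p / (p + 1) + 2 / (p + 1))" by (simp add: powr_add)
  also have "2 * p / (p + 1) + 2 / (p + 1) = 2" using assms by (simp add: divide_simps)
  also have "m powr 2 = m\<^sup>2" using pos by simp
  also have "\<dots> \<le> a\<^sup>2 + w\<^sup>2" by (auto simp: m_def max_def)
  finally show ?thesis by (simp add: w_def)
qed (use assms in auto)


text \<open>The absorption argument at a single point where the cutoff \<open>\<phi>\<close> is positive. Here \<open>a = |\<nabla>v|\<^sup>2 / v\<close>,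
  \<open>V = v\<^sub>t\<close>, \<open>L = \<Delta>v\<close>, \<open>g = M |\<nabla>v|\<^sup>q\<close>, while \<open>b\<close>, \<open>\<tau>\<close>, \<open>\<sigma>\<close> stand for \<open>\<nabla>\<phi> \<cdot> \<nabla>v\<close>, \<open>\<phi>\<^sub>t\<close>, \<open>\<Delta>\<phi>\<close>
  divided by \<open>\<phi>\<close>, and \<open>1 / r\<close> is the local length scale of \<open>\<phi>\<close>. The last four terms of the conclusion,
  multiplied by \<open>\<phi>\<close>, have integral zero.\<close>

definition absorbing ::
  "real \<Rightarrow> real \<Rightarrow> real \<Rightarrow> real \<Rightarrow> real \<Rightarrow> real \<Rightarrow> real \<Rightarrow> real \<Rightarrow> real \<Rightarrow> real \<Rightarrow> real \<Rightarrow> bool" where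
  "absorbing p \<alpha> \<nu> \<mu> \<kappa> \<epsilon> C cT cP cQ cY \<longleftrightarrow> (\<forall>M a v V L h g b \<tau> \<sigma> r y.
    0 < M \<longrightarrow> M < \<epsilon> \<longrightarrow> 0 \<le> a \<longrightarrow> 0 < v \<longrightarrow> 0 < r \<longrightarrow> 0 \<le> g \<longrightarrow>
    g\<^sup>2 \<le> M\<^sup>2 * (a\<^sup>2 + (v powr p)\<^sup>2) \<longrightarrow> b\<^sup>2 \<le> r\<^sup>2 * (a * v) \<longrightarrow> \<bar>\<tau>\<bar> \<le> r\<^sup>2 \<longrightarrow> \<bar>\<sigma>\<bar> \<le> r\<^sup>2 \<longrightarrow>
    L = V - v powr p - g + h \<longrightarrow>
    \<alpha> * a\<^sup>2 \<le> \<nu> * L\<^sup>2 + \<mu> * (a * L) + L * b + a * v * \<sigma> / 2 + \<kappa> * (a * b) - y \<longrightarrow>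
    (v powr p)\<^sup>2 \<le> C * (r powr (4 * p / (p - 1)) + h\<^sup>2) + cT * (L * V + V * b - \<tau> * (a * v) / 2)
      + cP * (v powr p * L + v powr p * b + p * v powr p * a)
      + cQ * (v powr p * V + \<tau> * (v powr p * v) / (p + 1)) + cY * y)"

text \<open>The sum \<open>Y\<close> of all quantities to be controlled is estimated at once, and
  each cutoff, shift or gradient-power term is bounded by one common error \<rho>. This gives
  \<open>Y\<close> at most null terms plus \<open>C6 * \<rho>\<close>, and the part of
  \<open>C6 * \<rho>\<close> proportional to \<open>Y\<close> is at most \<open>Y / 2\<close>. The
  hypotheses on \<alpha> and \<mu> are the positivity of the coefficients of \<open>a^2\<close> and
  \<open>a * w\<close>.\<close>

lemma absorbing_exists:
  fixes p \<alpha> \<nu> \<mu> \<kappa> :: real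
  assumes p: "1 < p" and \<alpha>: "0 < \<alpha>" and \<nu>: "0 \<le> \<nu>" "\<nu> \<le> 1" and \<mu>: "\<nu> * p < \<mu>" and \<kappa>: "0 \<le> \<kappa>"
  shows "\<exists>\<epsilon>>0. \<exists>C cT cP cQ cY. 0 \<le> C \<and> absorbing p \<alpha> \<nu> \<mu> \<kappa> \<epsilon> C cT cP cQ cY"
proof -
  define \<delta> where "\<delta> = \<mu> - \<nu> * p"
  have \<delta>: "\<delta> > 0" using \<mu> by (simp add: \<delta>_def)
  have "0 \<le> \<nu> * p" using \<nu> p by simp
  then have \<mu>0: "\<mu> \<ge> 0" using \<mu> by linarith
  \<comment> \<open>Chosen so that \<open>C4\<close> times the left side of \<open>I\<close>
    dominates \<open>a^2 + (1 + 5 * p) * (a * w)\<close>: in \<open>Y\<close> the square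
    \<open>w^2\<close> counts once directly and four times through \<open>L^2\<close>, and each copy
    costs \<open>p * (a * w)\<close>.\<close>
  define C4 where "C4 = 2 / \<alpha> + (1 + 5 * p) / \<delta>"
  have C4: "C4 > 0" unfolding C4_def using \<alpha> \<delta> p by (intro add_pos_pos divide_pos_pos) auto
  \<comment> \<open>\<open>C5\<close> is the total coefficient of \<open>V^2\<close>: one from
    \<open>Y\<close>, four through \<open>L^2\<close>, and the cost of absorbing
    \<open>\<mu> * (a * V)\<close>. \<open>C6\<close> below counts the copies of \<rho>, with
    \<open>19 = 5 * 3 + 4\<close> coming from the bounds \<open>w2\<close> and
    \<open>L2\<close>.\<close>
  define C5 where "C5 = 5 + C4 * (\<mu>\<^sup>2 / (2 * \<alpha>))"
  have C5: "C5 > 0" unfolding C5_def using C4 \<alpha> by (intro add_pos_nonneg) auto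
  define C6 where "C6 = C4 * (7 + \<kappa> + \<mu>) + 5 * C5 + 19"
  have C6: "C6 \<ge> 19" unfolding C6_def using C4 C5 \<kappa> \<mu>0 by simp
  \<comment> \<open>With this \<theta> and the \<epsilon> below, \<open>C6 * \<theta>\<close> and
    \<open>C6 * M\<close> are each at most 1/4, so half of \<open>Y\<close> survives.\<close>
  define \<theta> where "\<theta> = 1 / (4 * C6)"
  define \<eta> where "\<eta> = \<theta> / 2"
  have \<eta>: "\<eta> > 0" using C6 by (simp add: \<eta>_def \<theta>_def)
  \<comment> \<open>The factor produced by Young's inequality with parameter \<open>4 * l^2\<close>,
    which turns \<open>v^2 * r^4 / (4 * l)\<close> into \<open>l * w^2\<close> plus a multiple of
    the power of \<open>r\<close>.\<close>
  define c1 where "c1 l = (4 * l\<^sup>2) powr (- 1 / (p - 1)) / (4 * l)" for l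
  define K where "K = 1 + 1 / (4 * \<eta>) + c1 \<eta> + c1 (4 * \<eta>\<^sup>2) / (4 * \<eta>)"
  have c1: "c1 l \<ge> 0" if "l > 0" for l using that by (simp add: c1_def)
  have K: "1 \<le> K" "1 / (4 * \<eta>) \<le> K" "c1 \<eta> \<le> K" "c1 (4 * \<eta>\<^sup>2) / (4 * \<eta>) \<le> K"
    using \<eta> c1[of \<eta>] c1[of "4 * \<eta>\<^sup>2"] by (auto simp: K_def add_nonneg_nonneg)
  define \<epsilon> where "\<epsilon> = 1 / (4 * C6)"
  have \<epsilon>: "\<epsilon> > 0" "\<epsilon> \<le> 1" using C6 by (auto simp: \<epsilon>_def)
  show ?thesis
    unfolding absorbing_def
  \<comment> \<open>The witnesses are the coefficients of \<open>T\<close>, \<open>P\<close>,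
    \<open>Q\<close> and \<open>y\<close> in the final bound for \<open>Y\<close>, doubled because
    only \<open>Y / 2\<close> remains on the left.\<close>
  proof (rule exI[of _ \<epsilon>], rule conjI[OF \<epsilon>(1)], rule exI[of _ "2 * C6 * K"], rule exI[of _ "2 * (C4 * \<nu> + C5)"],
      rule exI[of _ "2 * (- C4 * \<nu> - 5)"], rule exI[of _ "2 * (C5 + 5)"], rule exI[of _ "2 * (- C4)"], intro conjI allI impI)
    show "0 \<le> 2 * C6 * K" using C6 K(1) by simp
    fix M a v V L h g b \<tau> \<sigma> r y :: real
    assume M: "0 < M" "M < \<epsilon>" and a: "0 \<le> a" and v: "0 < v" and r: "0 < r" and g: "0 \<le> g"
      "g\<^sup>2 \<le> M\<^sup>2 * (a\<^sup>2 + (v powr p)\<^sup>2)" and b: "b\<^sup>2 \<le> r\<^sup>2 * (a * v)" and \<tau>: "\<bar>\<tau>\<bar> \<le> r\<^sup>2" and \<sigma>: "\<bar>\<sigma>\<bar> \<le> r\<^sup>2"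
      and L: "L = V - v powr p - g + h"
      and main: "\<alpha> * a\<^sup>2 \<le> \<nu> * L\<^sup>2 + \<mu> * (a * L) + L * b + a * v * \<sigma> / 2 + \<kappa> * (a * b) - y"
    define w where "w = v powr p"
    have w: "w > 0" using v by (simp add: w_def)
    define z where "z = r powr (4 * p / (p - 1))"
    have z: "z \<ge> 0" by (simp add: z_def)
    define Y where "Y = a\<^sup>2 + a * w + V\<^sup>2 + w\<^sup>2 + L\<^sup>2"
    have aw: "a * w \<ge> 0" using a w by simp
    have sq: "a\<^sup>2 \<ge> 0" "V\<^sup>2 \<ge> 0" "w\<^sup>2 \<ge> 0" "L\<^sup>2 \<ge> 0" "h\<^sup>2 \<ge> 0" by auto
    have Y: "a\<^sup>2 + w\<^sup>2 \<le> Y" "a\<^sup>2 + w\<^sup>2 + L\<^sup>2 \<le> Y" "a\<^sup>2 + w\<^sup>2 + V\<^sup>2 \<le> Y" "0 \<le> Y" "a\<^sup>2 \<le> Y" "V\<^sup>2 \<le> Y" "w\<^sup>2 \<le> Y" "L\<^sup>2 \<le> Y"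
      using aw sq by (auto simp: Y_def)
    define \<rho> where "\<rho> = \<theta> * Y + K * (z + h\<^sup>2) + M * Y"
    have \<theta>: "\<theta> = 2 * \<eta>" "\<theta> > 0" using \<eta> by (auto simp: \<eta>_def)
    have \<theta>Y: "\<theta> * Y = 2 * (\<eta> * Y)" "0 \<le> \<eta> * Y" using \<theta> \<eta> Y by auto
    have parts: "0 \<le> \<theta> * Y" "0 \<le> K * z" "0 \<le> K * h\<^sup>2" "0 \<le> M * Y" using \<theta> Y K(1) z M by auto
    have \<rho>: "\<theta> * Y + K * z \<le> \<rho>" "\<theta> * Y + K * h\<^sup>2 \<le> \<rho>" "M * Y \<le> \<rho>" "0 \<le> \<rho>" "M * Y + K * h\<^sup>2 \<le> \<rho>"
      using parts by (auto simp: \<rho>_def distrib_left)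
    have vr: "v\<^sup>2 * r ^ 4 / (4 * l) \<le> l * w\<^sup>2 + c1 l * z" if l: "l > 0" for l
    proof -
      have "v\<^sup>2 * r ^ 4 / (4 * l) \<le> ((4 * l\<^sup>2) * w\<^sup>2 + (4 * l\<^sup>2) powr (- 1 / (p - 1)) * z) / (4 * l)"
        unfolding w_def z_def using young_critical_power[OF p v r, of "4 * l\<^sup>2"] l by (intro divide_right_mono) auto
      also have "\<dots> = l * w\<^sup>2 + c1 l * z" using l by (simp add: c1_def field_simps power2_eq_square)
      finally show ?thesis .
    qed
    have rxv: "r\<^sup>2 * (x * v) \<le> l * x\<^sup>2 + l * w\<^sup>2 + c1 l * z" if "l > 0" for x l
    proof -
      have "x * (r\<^sup>2 * v) \<le> l * x\<^sup>2 + (r\<^sup>2 * v)\<^sup>2 / (4 * l)"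
        using mult_le_weighted_squares[OF that, of x "r\<^sup>2 * v"] by linarith
      moreover have "(r\<^sup>2 * v)\<^sup>2 = v\<^sup>2 * r ^ 4" by (simp add: power_mult_distrib flip: power_mult)
      ultimately show ?thesis using vr[OF that] by (simp add: mult_ac)
    qed
    have s: "r\<^sup>2 * (a * v) \<le> l * Y + c1 l * z" if "l > 0" for l
    proof -
      have "l * (a\<^sup>2 + w\<^sup>2) \<le> l * Y" using that Y by simp
      then show ?thesis using rxv[OF that, of a] by (simp add: distrib_left)
    qed
    have Kz: "c1 \<eta> * z \<le> K * z" "c1 (4 * \<eta>\<^sup>2) / (4 * \<eta>) * z \<le> K * z"
      by (rule mult_right_mono[OF K(3) z], rule mult_right_mono[OF K(4) z])
    have s\<rho>: "r\<^sup>2 * (a * v) \<le> \<rho>"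
      using s[OF \<eta>] Kz \<rho>(1) parts \<theta>Y by linarith
    have av: "0 \<le> a * v" using a v by simp
    have wv: "0 \<le> w * v" using w v by simp
    have \<tau>G: "\<bar>\<tau> * (a * v)\<bar> \<le> \<rho>"
      using mult_right_mono[OF \<tau> av] a v s\<rho> by (simp add: abs_mult)
    have \<sigma>G: "\<bar>a * v * \<sigma>\<bar> \<le> \<rho>"
      using mult_right_mono[OF \<sigma> av] a v s\<rho> by (simp add: abs_mult mult_ac)
    have \<tau>w: "\<bar>\<tau> * (w * v)\<bar> \<le> \<rho>"
    proof -
      have "\<eta> * w\<^sup>2 \<le> \<eta> * Y" using \<eta> Y by simp
      then have "r\<^sup>2 * (w * v) \<le> \<rho>" using rxv[OF \<eta>, of w] Kz \<rho>(1) \<theta>Y by linarith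
      moreover have "\<bar>\<tau> * (w * v)\<bar> = \<bar>\<tau>\<bar> * (w * v)" using w v by (simp add: abs_mult)
      ultimately show ?thesis using mult_right_mono[OF \<tau> wv] by linarith
    qed
    have xb: "\<bar>x * b\<bar> \<le> \<rho>" if "x\<^sup>2 \<le> Y" for x
    proof -
      have "\<bar>x * b\<bar> \<le> \<eta> * x\<^sup>2 + b\<^sup>2 / (4 * \<eta>)" by (rule mult_le_weighted_squares[OF \<eta>])
      \<comment> \<open>The parameter \<open>4 * \<eta>^2\<close> becomes \<eta> after the division
        by \<open>4 * \<eta>\<close>.\<close>
      also have "b\<^sup>2 / (4 * \<eta>) \<le> (4 * \<eta>\<^sup>2 * Y + c1 (4 * \<eta>\<^sup>2) * z) / (4 * \<eta>)"
        using b s[of "4 * \<eta>\<^sup>2"] \<eta> by (intro divide_right_mono) auto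
      also have "\<dots> = \<eta> * Y + c1 (4 * \<eta>\<^sup>2) / (4 * \<eta>) * z" using \<eta> by (simp add: field_simps power2_eq_square)
      finally have "\<bar>x * b\<bar> \<le> \<eta> * x\<^sup>2 + (\<eta> * Y + K * z)" using Kz by linarith
      moreover have "\<eta> * x\<^sup>2 \<le> \<eta> * Y" using \<eta> that by simp
      ultimately show ?thesis using \<rho>(1) \<theta>Y by linarith
    qed
    have xh: "\<bar>x * h\<bar> \<le> \<rho>" if "x\<^sup>2 \<le> Y" for x
    proof -
      have "\<bar>x * h\<bar> \<le> \<eta> * x\<^sup>2 + h\<^sup>2 / (4 * \<eta>)" by (rule mult_le_weighted_squares[OF \<eta>])
      moreover have "h\<^sup>2 / (4 * \<eta>) \<le> K * h\<^sup>2" using mult_right_mono[OF K(2), of "h\<^sup>2"] by simp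
      moreover have "\<eta> * x\<^sup>2 \<le> \<eta> * Y" using \<eta> that by simp
      ultimately show ?thesis using \<rho>(2) \<theta>Y parts by linarith
    qed
    have xg: "\<bar>x * g\<bar> \<le> \<rho>" if "a\<^sup>2 + w\<^sup>2 + x\<^sup>2 \<le> Y" for x
    proof -
      \<comment> \<open>The weight \<open>M / 2\<close> balances the factor \<open>M^2\<close> in
        the bound for \<open>g^2\<close>, so that the error is proportional to
        \<open>M\<close>.\<close>
      have "\<bar>x * g\<bar> \<le> (M / 2) * x\<^sup>2 + g\<^sup>2 / (4 * (M / 2))" using M by (intro mult_le_weighted_squares) auto
      also have "g\<^sup>2 / (4 * (M / 2)) \<le> M\<^sup>2 * (a\<^sup>2 + w\<^sup>2) / (4 * (M / 2))"
        using g M unfolding w_def by (intro divide_right_mono) auto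
      also have "\<dots> = (M / 2) * (a\<^sup>2 + w\<^sup>2)" using M by (simp add: field_simps power2_eq_square)
      finally have "\<bar>x * g\<bar> \<le> (M / 2) * (a\<^sup>2 + w\<^sup>2 + x\<^sup>2)" by (simp add: algebra_simps)
      also have "\<dots> \<le> (M / 2) * Y" using M that by simp
      finally show ?thesis using parts \<rho> by linarith
    qed
    have \<tau>w': "\<bar>\<tau> * (w * v) / (p + 1)\<bar> \<le> \<rho>"
    proof -
      have "\<bar>\<tau> * (w * v) / (p + 1)\<bar> = \<bar>\<tau> * (w * v)\<bar> / (p + 1)" using p by simp
      also have "\<dots> \<le> \<rho> / 1" using \<tau>w \<rho>(4) p by (intro frac_le) auto
      finally show ?thesis by simp
    qed
    note bounds = \<tau>w' \<tau>G \<sigma>G \<tau>w xb[OF Y(5)] xb[OF Y(6)] xb[OF Y(7)] xb[OF Y(8)] xh[OF Y(5)] xh[OF Y(6)] xh[OF Y(7)] xh[OF Y(8)]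
      xg[OF Y(2)] xg[OF Y(3)]
    note E = bounds[THEN abs_le_D1] bounds[THEN abs_le_D2]
    define T where "T = L * V + V * b - \<tau> * (a * v) / 2"
    define P where "P = w * L + w * b + p * w * a"
    define Q where "Q = w * V + \<tau> * (w * v) / (p + 1)"
    have Leq: "L = V - w - g + h" and Veq: "V = L + w + g - h" and weq: "w = V - L - g + h"
      using L by (simp_all add: w_def)
    have V2: "V\<^sup>2 \<le> T + Q + 5 * \<rho>"
    proof -
      have "V\<^sup>2 = L * V + w * V + V * g - V * h" using arg_cong[OF Veq, of "(*) V"] by (simp add: power2_eq_square algebra_simps)
      then show ?thesis using E unfolding T_def Q_def by linarith
    qed
    have w2: "w\<^sup>2 \<le> Q - P + p * (a * w) + 3 * \<rho>"
    proof -
      have "w\<^sup>2 = w * V - w * L - w * g + w * h" using arg_cong[OF weq, of "(*) w"] by (simp add: power2_eq_square algebra_simps)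
      moreover have "w * g \<ge> 0" using w g by simp
      moreover have "p * w * a = p * (a * w)" by simp
      ultimately show ?thesis using E unfolding P_def Q_def by linarith
    qed
    have L2: "L\<^sup>2 \<le> 4 * V\<^sup>2 + 4 * w\<^sup>2 + 4 * \<rho>"
    proof -
      have four: "(A + B + C + D)\<^sup>2 \<le> 4 * (A\<^sup>2 + B\<^sup>2 + C\<^sup>2 + D\<^sup>2)" for A B C D :: real
      proof -
        have "0 \<le> (A - B)\<^sup>2 + (A - C)\<^sup>2 + (A - D)\<^sup>2 + (B - C)\<^sup>2 + (B - D)\<^sup>2 + (C - D)\<^sup>2" by simp
        then show ?thesis by (simp add: power2_eq_square algebra_simps)
      qed
      have L4: "L\<^sup>2 \<le> 4 * (V\<^sup>2 + w\<^sup>2 + g\<^sup>2 + h\<^sup>2)"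
        using four[of V "- w" "- g" h] L by (simp add: w_def)
      have "g\<^sup>2 \<le> M * Y"
      proof -
        have "g\<^sup>2 \<le> M\<^sup>2 * Y" using g(2) Y(1) order_trans mult_left_mono[of "a\<^sup>2 + w\<^sup>2" Y "M\<^sup>2"] by (simp add: w_def)
        also have "\<dots> \<le> M * Y" using M \<epsilon> Y(4) by (intro mult_right_mono) (auto simp: power2_eq_square)
        finally show ?thesis .
      qed
      moreover have "M * Y + h\<^sup>2 \<le> \<rho>"
        using mult_right_mono[OF K(1), of "h\<^sup>2"] \<rho>(5) order_trans[OF add_left_mono] by simp
      ultimately have "g\<^sup>2 + h\<^sup>2 \<le> \<rho>" by linarith
      then have "4 * (g\<^sup>2 + h\<^sup>2) \<le> 4 * \<rho>" by simp
      moreover have "4 * (V\<^sup>2 + w\<^sup>2 + g\<^sup>2 + h\<^sup>2) = 4 * V\<^sup>2 + 4 * w\<^sup>2 + 4 * (g\<^sup>2 + h\<^sup>2)" by simp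
      ultimately show ?thesis using L4 by linarith
    qed
    have aV: "\<mu> * (a * V) \<le> \<alpha> / 2 * a\<^sup>2 + \<mu>\<^sup>2 / (2 * \<alpha>) * V\<^sup>2"
      using mult_le_weighted_squares[of "\<alpha> / 2" a "\<mu> * V"] \<alpha> by (simp add: power_mult_distrib mult_ac)
    \<comment> \<open>One factor \<open>L\<close> in \<open>L^2\<close> and in \<open>a * L\<close>
      is expanded by the equation. The first expansion yields \<open>\<nu> * p * (a * w)\<close>
      through \<open>- P\<close>, the second \<open>- \<mu> * (a * w)\<close>; moved to the left
      they combine to \<delta>.\<close>
    have I: "\<alpha> / 2 * a\<^sup>2 + \<delta> * (a * w) \<le> \<nu> * (T - P) - y + (7 + \<kappa> + \<mu>) * \<rho> + \<mu>\<^sup>2 / (2 * \<alpha>) * V\<^sup>2"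
    proof -
      have "L\<^sup>2 = L * V - w * L - L * g + L * h" using arg_cong[OF Leq, of "(*) L"] by (simp add: power2_eq_square algebra_simps)
      moreover have pwa: "p * w * a = p * (a * w)" by simp
      ultimately have "L\<^sup>2 \<le> T - P + p * (a * w) + 5 * \<rho>"
        using E pwa unfolding T_def P_def by linarith
      then have "\<nu> * L\<^sup>2 \<le> \<nu> * (T - P + p * (a * w) + 5 * \<rho>)" using \<nu> by (intro mult_left_mono)
      moreover have "\<nu> * \<rho> \<le> \<rho>" using mult_right_mono[OF \<nu>(2) \<rho>(4)] by simp
      moreover have "\<mu> * (a * L) \<le> \<mu> * (a * V) - \<mu> * (a * w) + \<mu> * \<rho>"
      proof -
        have "a * L = a * V - a * w - a * g + a * h" using arg_cong[OF Leq, of "(*) a"] by (simp add: algebra_simps)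
        moreover have "a * g \<ge> 0" using a g by simp
        ultimately have "a * L \<le> a * V - a * w + \<rho>" using E by linarith
        then have "\<mu> * (a * L) \<le> \<mu> * (a * V - a * w + \<rho>)" using \<mu>0 by (intro mult_left_mono)
        then show ?thesis by (simp add: algebra_simps)
      qed
      moreover have "\<kappa> * (a * b) \<le> \<kappa> * \<rho>" using E \<kappa> by (intro mult_left_mono) auto
      moreover have "L * b \<le> \<rho>" "a * v * \<sigma> / 2 \<le> \<rho>" using E \<rho>(4) by auto
      ultimately show ?thesis using main aV by (simp add: \<delta>_def algebra_simps)
    qed
    have "a\<^sup>2 + (1 + 5 * p) * (a * w) \<le> C4 * (\<alpha> / 2 * a\<^sup>2 + \<delta> * (a * w))"
    proof -
      have "C4 * (\<alpha> / 2) \<ge> 1" "C4 * \<delta> \<ge> 1 + 5 * p"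
        using \<alpha> \<delta> p by (auto simp: C4_def field_simps)
      then have "1 * a\<^sup>2 \<le> C4 * (\<alpha> / 2) * a\<^sup>2" "(1 + 5 * p) * (a * w) \<le> C4 * \<delta> * (a * w)"
        using aw by (intro mult_right_mono; simp)+
      then show ?thesis by (simp add: algebra_simps)
    qed
    also have "\<dots> \<le> C4 * (\<nu> * (T - P) - y + (7 + \<kappa> + \<mu>) * \<rho> + \<mu>\<^sup>2 / (2 * \<alpha>) * V\<^sup>2)"
      using I C4 by simp
    finally have "Y \<le> C4 * (\<nu> * (T - P) - y + (7 + \<kappa> + \<mu>) * \<rho>) + C5 * V\<^sup>2 + 5 * (Q - P) + 19 * \<rho>"
      using L2 w2 unfolding Y_def C5_def by (simp add: algebra_simps)
    also have "C5 * V\<^sup>2 \<le> C5 * (T + Q + 5 * \<rho>)" using V2 C5 by simp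
    finally have "Y \<le> C4 * (\<nu> * (T - P) - y) + C5 * (T + Q) + 5 * (Q - P) + C6 * \<rho>"
      by (simp add: C6_def algebra_simps)
    moreover have "C6 * \<rho> \<le> Y / 2 + C6 * K * (z + h\<^sup>2)"
    proof -
      have "C6 * \<theta> = 1 / 4" using C6 by (simp add: \<theta>_def)
      moreover have "C6 * M \<le> 1 / 4" using mult_left_mono[of M \<epsilon> C6] M C6 by (simp add: \<epsilon>_def)
      ultimately have "C6 * \<theta> * Y + C6 * M * Y \<le> 1 / 4 * Y + 1 / 4 * Y" using Y(4)
        by (intro add_mono mult_right_mono) auto
      then show ?thesis by (simp add: \<rho>_def algebra_simps)
    qed
    moreover have "2 * C6 * K * (z + h\<^sup>2) = 2 * (C6 * K * (z + h\<^sup>2))" by simp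
    ultimately have "w\<^sup>2 \<le> 2 * (C4 * (\<nu> * (T - P) - y) + C5 * (T + Q) + 5 * (Q - P)) + 2 * C6 * K * (z + h\<^sup>2)"
      using Y(7) by argo
    then show "(v powr p)\<^sup>2 \<le> 2 * C6 * K * (r powr (4 * p / (p - 1)) + h\<^sup>2)
      + 2 * (C4 * \<nu> + C5) * (L * V + V * b - \<tau> * (a * v) / 2)
      + 2 * (- C4 * \<nu> - 5) * (v powr p * L + v powr p * b + p * v powr p * a)
      + 2 * (C5 + 5) * (v powr p * V + \<tau> * (v powr p * v) / (p + 1)) + 2 * (- C4) * y"
      unfolding w_def[symmetric] z_def[symmetric] T_def[symmetric] P_def[symmetric] Q_def[symmetric]
      by (simp add: algebra_simps)
  qed
qed


text \<open>Cauchy-Schwarz on the diagonal, \<open>(tr A)^2 \<le> N * |A|^2\<close>, for the matrix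
  with entries \<open>H i j - k * D i * D j\<close>.\<close>

lemma trace_square_le:
  fixes H :: "'n::finite \<Rightarrow> 'n \<Rightarrow> real" and D :: "'n \<Rightarrow> real"
  shows "((\<Sum>i\<in>UNIV. H i i) - k * (\<Sum>i\<in>UNIV. (D i)\<^sup>2))\<^sup>2 / real CARD('n)
    \<le> (\<Sum>i\<in>UNIV. \<Sum>j\<in>UNIV. (H i j)\<^sup>2) - 2 * k * (\<Sum>i\<in>UNIV. \<Sum>j\<in>UNIV. H i j * D i * D j) + k\<^sup>2 * (\<Sum>i\<in>UNIV. (D i)\<^sup>2)\<^sup>2"
proof -
  define A where "A i j = H i j - k * (D i * D j)" for i j
  have "(\<Sum>i\<in>UNIV. H i i) - k * (\<Sum>i\<in>UNIV. (D i)\<^sup>2) = (\<Sum>i\<in>UNIV. A i i)"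
    by (simp add: A_def sum_subtractf sum_distrib_left power2_eq_square)
  then have "((\<Sum>i\<in>UNIV. H i i) - k * (\<Sum>i\<in>UNIV. (D i)\<^sup>2))\<^sup>2 = (\<Sum>i\<in>UNIV. A i i)\<^sup>2" by simp
  also have "\<dots> \<le> (\<Sum>i\<in>UNIV. (A i i)\<^sup>2) * real CARD('n)"
    using sum_squared_le_sum_of_squares[of "\<lambda>i. A i i" UNIV] by (simp add: mult.commute)
  finally have "((\<Sum>i\<in>UNIV. H i i) - k * (\<Sum>i\<in>UNIV. (D i)\<^sup>2))\<^sup>2 / real CARD('n) \<le> (\<Sum>i\<in>UNIV. (A i i)\<^sup>2)"
    by (simp add: pos_divide_le_eq)
  also have "\<dots> \<le> (\<Sum>i\<in>UNIV. \<Sum>j\<in>UNIV. (A i j)\<^sup>2)"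
    by (intro sum_mono member_le_sum[of _ UNIV "\<lambda>j. (A _ j)\<^sup>2"]) auto
  also have "\<dots> = (\<Sum>i\<in>UNIV. \<Sum>j\<in>UNIV. (H i j)\<^sup>2 - 2 * k * (H i j * D i * D j) + k\<^sup>2 * ((D i)\<^sup>2 * (D j)\<^sup>2))"
    by (intro sum.cong refl) (simp add: A_def power2_eq_square algebra_simps)
  also have "\<dots> = (\<Sum>i\<in>UNIV. \<Sum>j\<in>UNIV. (H i j)\<^sup>2) - 2 * k * (\<Sum>i\<in>UNIV. \<Sum>j\<in>UNIV. H i j * D i * D j)
      + k\<^sup>2 * (\<Sum>i\<in>UNIV. \<Sum>j\<in>UNIV. (D i)\<^sup>2 * (D j)\<^sup>2)"
    by (simp only: sum.distrib sum_subtractf sum_distrib_left)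
  also have "(\<Sum>i\<in>UNIV. \<Sum>j\<in>UNIV. (D i)\<^sup>2 * (D j)\<^sup>2) = (\<Sum>i\<in>UNIV. (D i)\<^sup>2)\<^sup>2"
    by (simp add: sum_product power2_eq_square[of "sum _ _"])
  finally show ?thesis .
qed

section \<open>The parabolic cutoff\<close>

text \<open>An exponent of at least two makes the power of the positive part differentiable at its
  kink: the difference quotient at 0 is at most \<open>\<bar>h\<bar> ^ Suc k\<close>.\<close>

lemma has_real_derivative_pos_part_power:
  "((\<lambda>s. max 0 s ^ Suc (Suc k)) has_real_derivative real (Suc (Suc k)) * max 0 s ^ Suc k) (at s)"
proof (cases s "0 :: real" rule: linorder_cases)
  case less
  have "((\<lambda>s. 0) has_real_derivative 0) (at s)" by simp
  then have "((\<lambda>s. max 0 s ^ Suc (Suc k)) has_real_derivative 0) (at s)"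
    by (rule has_field_derivative_transform_within_open[where S = "{..<0}"]) (use less in auto)
  then show ?thesis using less by simp
next
  case greater
  have "((\<lambda>s. s ^ Suc (Suc k)) has_real_derivative real (Suc (Suc k)) * s ^ Suc k) (at s)"
    using DERIV_pow[of "Suc (Suc k)" s] by simp
  then have "((\<lambda>s. max 0 s ^ Suc (Suc k)) has_real_derivative real (Suc (Suc k)) * s ^ Suc k) (at s)"
    by (rule has_field_derivative_transform_within_open[where S = "{0<..}"]) (use greater in auto)
  then show ?thesis using greater by simp
next
  case equal
  have "((\<lambda>h. max 0 h ^ Suc (Suc k) / h) \<longlongrightarrow> 0) (at (0::real))"
  proof (rule Lim_null_comparison)
    show "\<forall>\<^sub>F h in at (0::real). norm (max 0 h ^ Suc (Suc k) / h) \<le> \<bar>h\<bar> ^ Suc k"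
    proof (rule always_eventually, rule allI)
      fix h :: real
      show "norm (max 0 h ^ Suc (Suc k) / h) \<le> \<bar>h\<bar> ^ Suc k"
      proof (cases "h > 0")
        case False
        then have "max 0 h = 0" by simp
        then have "norm (max 0 h ^ Suc (Suc k) / h) = 0" by simp
        then show ?thesis by (metis abs_ge_zero zero_le_power)
      qed simp
    qed
    have "((\<lambda>h. \<bar>h\<bar> ^ Suc k) \<longlongrightarrow> \<bar>0\<bar> ^ Suc k) (at (0::real))" by (intro tendsto_intros)
    then show "((\<lambda>h. \<bar>h\<bar> ^ Suc k) \<longlongrightarrow> 0) (at (0::real))" by simp
  qed
  then show ?thesis using equal by (simp add: DERIV_def)
qed

abbreviation space_dir :: "'n::finite \<Rightarrow> (real^'n) \<times> real" where "space_dir i \<equiv> (axis i 1, 0)"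
abbreviation time_dir :: "(real^'n::finite) \<times> real" where "time_dir \<equiv> (0, 1)"

text \<open>Squares with weights \<open>R^2\<close> and \<open>R^4\<close> respect the parabolic
  scaling \<open>x ~ R\<close>, \<open>t ~ R^2\<close> and keep the function polynomial.\<close>

definition barrier :: "real \<Rightarrow> (real^'n::finite) \<times> real \<Rightarrow> real" where
  "barrier R z = 1 - (fst z \<bullet> fst z) / R\<^sup>2 - (snd z)\<^sup>2 / R ^ 4"

definition profile :: "real \<Rightarrow> (real^'n::finite) \<times> real \<Rightarrow> real" where
  "profile R z = max 0 (barrier R z)"

lemma barrier_space_deriv:
  fixes i :: "'n::finite"
  shows "has_dir_deriv (space_dir i) (barrier R) (\<lambda>z. - 2 * (fst z $ i) / R\<^sup>2)"
  unfolding has_dir_deriv_def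
proof
  fix z :: "(real^'n) \<times> real"
  have eq: "(fst z + s *\<^sub>R axis i 1) \<bullet> (fst z + s *\<^sub>R axis i 1) = fst z \<bullet> fst z + 2 * (fst z $ i) * s + s\<^sup>2" for s
    by (simp add: inner_add_left inner_add_right inner_axis inner_commute[of "axis i 1"] power2_eq_square distrib_left)
  show "((\<lambda>s. barrier R (z + s *\<^sub>R space_dir i)) has_real_derivative - 2 * (fst z $ i) / R\<^sup>2) (at 0)"
    unfolding barrier_def fst_add fst_scaleR fst_conv eq divide_inverse
    by (auto intro!: derivative_eq_intros)
qed

lemma barrier_time_deriv: "has_dir_deriv time_dir (barrier R) (\<lambda>z. - 2 * snd z / R ^ 4)"
  unfolding has_dir_deriv_def barrier_def divide_inverse by (auto intro!: derivative_eq_intros)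

lemma coordinate_space_deriv: "has_dir_deriv (space_dir i) (\<lambda>z. fst z $ i) (\<lambda>z. 1)"
  unfolding has_dir_deriv_def by (auto intro!: derivative_eq_intros simp: axis_def)

lemma continuous_barrier: "continuous_on UNIV (barrier R)"
  unfolding barrier_def[abs_def] divide_inverse by (intro continuous_intros)

lemma continuous_profile: "continuous_on UNIV (profile R)"
  unfolding profile_def[abs_def] by (intro continuous_intros continuous_barrier)

lemma profile_bounds:
  assumes "R > 0"
  shows "0 \<le> profile R z" "profile R z \<le> 1"
  by (auto simp: profile_def barrier_def field_simps)

lemma profile_support:
  assumes R: "R > 0" and pos: "profile R z \<noteq> 0"
  shows "fst z \<bullet> fst z \<le> R\<^sup>2" "\<bar>snd z\<bar> \<le> R\<^sup>2"
proof -
  have *: "(fst z \<bullet> fst z) / R\<^sup>2 + (snd z)\<^sup>2 / R ^ 4 \<le> 1"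
    using pos by (simp add: profile_def barrier_def max_def split: if_splits)
  have nn: "0 \<le> (fst z \<bullet> fst z) / R\<^sup>2" "0 \<le> (snd z)\<^sup>2 / R ^ 4" by auto
  have "(fst z \<bullet> fst z) / R\<^sup>2 \<le> 1" using * nn by linarith
  then show "fst z \<bullet> fst z \<le> R\<^sup>2" using R by simp
  have "(snd z)\<^sup>2 / R ^ 4 \<le> 1" using * nn by linarith
  then have "(snd z)\<^sup>2 \<le> (R\<^sup>2)\<^sup>2" using R by (simp flip: power_mult)
  then show "\<bar>snd z\<bar> \<le> R\<^sup>2" by (simp only: power2_le_iff_abs_le zero_le_power2)
qed

lemma profile_eq_0_outside:
  assumes R: "R > 0" and z: "R + R\<^sup>2 < norm z"
  shows "profile R z = 0"
proof (rule ccontr)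
  assume n: "profile R z \<noteq> 0"
  have "(norm (fst z))\<^sup>2 \<le> R\<^sup>2" using profile_support[OF R n] by (simp add: power2_norm_eq_inner)
  then have "norm (fst z) \<le> R" using R by (simp add: power2_le_iff_abs_le)
  moreover have "norm z \<le> norm (fst z) + norm (snd z)"
    using norm_Pair_le[of "fst z" "snd z"] by simp
  ultimately show False using z profile_support(2)[OF R n] by simp
qed

text \<open>The parameter \<open>index\<close> carries no information; it ties the locale to the dimension \<open>CARD('n)\<close>.\<close>

locale cutoff =
  fixes R :: real and k :: nat and index :: "'n::finite itself"
  assumes R: "R > 0"
begin

definition m :: real where "m = real (k + 3)"

text \<open>With exponent at least three, the second derivatives retain a factor
  \<open>profile\<close> and are continuous across the edge of the support. The free
  \<open>k\<close> allows larger exponents, as \<open>scaled_power_bound\<close> requires.\<close>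

definition \<phi> :: "(real^'n) \<times> real \<Rightarrow> real" where
  "\<phi> z = profile R z ^ (k + 3)"

definition \<phi>x :: "'n \<Rightarrow> (real^'n) \<times> real \<Rightarrow> real" where
  "\<phi>x i z = m * profile R z ^ (k + 2) * (- 2 * (fst z $ i) / R\<^sup>2)"

definition \<phi>xx :: "'n \<Rightarrow> (real^'n) \<times> real \<Rightarrow> real" where
  "\<phi>xx i z = m * (m - 1) * profile R z ^ (k + 1) * (- 2 * (fst z $ i) / R\<^sup>2)\<^sup>2
     + m * profile R z ^ (k + 2) * (- 2 / R\<^sup>2)"

definition \<phi>t :: "(real^'n) \<times> real \<Rightarrow> real" where
  "\<phi>t z = m * profile R z ^ (k + 2) * (- 2 * snd z / R ^ 4)"

lemma profile_power_deriv:
  fixes g' :: "(real^'n) \<times> real \<Rightarrow> real"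
  assumes "has_dir_deriv d (barrier R) g'"
  shows "has_dir_deriv d (\<lambda>z. profile R z ^ (j + 2)) (\<lambda>z. real (j + 2) * profile R z ^ (j + 1) * g' z)"
  using has_dir_deriv_chain[OF assms has_real_derivative_pos_part_power[of j]]
  by (simp add: profile_def)

lemma \<phi>_derivs:
  "has_dir_deriv (space_dir i) \<phi> (\<phi>x i)" "has_dir_deriv (space_dir i) (\<phi>x i) (\<phi>xx i)"
  "has_dir_deriv time_dir \<phi> \<phi>t"
proof -
  show "has_dir_deriv (space_dir i) \<phi> (\<phi>x i)" "has_dir_deriv time_dir \<phi> \<phi>t"
    using profile_power_deriv[OF barrier_space_deriv, of i, where j = "k + 1"] profile_power_deriv[OF barrier_time_deriv, where j = "k + 1"]
    by (simp_all add: \<phi>_def[abs_def] \<phi>x_def[abs_def] \<phi>t_def[abs_def] m_def numeral_3_eq_3 add.commute)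
  have "has_dir_deriv (space_dir i) (\<lambda>z :: (real^'n) \<times> real. m * profile R z ^ (k + 2) * ((- 2 / R\<^sup>2) * (fst z $ i)))
    (\<lambda>z. (m * (real (k + 2) * profile R z ^ (k + 1) * (- 2 * (fst z $ i) / R\<^sup>2))) * ((- 2 / R\<^sup>2) * (fst z $ i))
      + m * profile R z ^ (k + 2) * ((- 2 / R\<^sup>2) * 1))"
    by (intro has_dir_deriv_mult has_dir_deriv_cmult profile_power_deriv barrier_space_deriv coordinate_space_deriv)
  moreover have "real (k + 2) = m - 1" by (simp add: m_def)
  ultimately have "has_dir_deriv (space_dir i) (\<lambda>z :: (real^'n) \<times> real. m * profile R z ^ (k + 2) * ((- 2 / R\<^sup>2) * (fst z $ i)))
    (\<lambda>z. (m * ((m - 1) * profile R z ^ (k + 1) * (- 2 * (fst z $ i) / R\<^sup>2))) * ((- 2 / R\<^sup>2) * (fst z $ i))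
      + m * profile R z ^ (k + 2) * ((- 2 / R\<^sup>2) * 1))"
    by (simp only:)
  moreover have "(\<lambda>z :: (real^'n) \<times> real. m * profile R z ^ (k + 2) * ((- 2 / R\<^sup>2) * (fst z $ i))) = \<phi>x i"
    by (simp add: \<phi>x_def[abs_def])
  moreover have "(\<lambda>z. (m * ((m - 1) * profile R z ^ (k + 1) * (- 2 * (fst z $ i) / R\<^sup>2))) * ((- 2 / R\<^sup>2) * (fst z $ i))
      + m * profile R z ^ (k + 2) * ((- 2 / R\<^sup>2) * 1)) = \<phi>xx i"
    by (simp add: \<phi>xx_def[abs_def] power2_eq_square mult_ac)
  ultimately show "has_dir_deriv (space_dir i) (\<phi>x i) (\<phi>xx i)" by (simp only:)
qed

lemma \<phi>_continuous:
  "continuous_on UNIV \<phi>" "continuous_on UNIV (\<phi>x i)" "continuous_on UNIV (\<phi>xx i)" "continuous_on UNIV \<phi>t"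
  unfolding \<phi>_def[abs_def] \<phi>x_def[abs_def] \<phi>xx_def[abs_def] \<phi>t_def[abs_def] divide_inverse
  by (intro continuous_intros continuous_profile)+

lemma \<phi>_zero:
  assumes "profile R z = 0" shows "\<phi> z = 0" "\<phi>x i z = 0" "\<phi>xx i z = 0" "\<phi>t z = 0"
  using assms by (auto simp: \<phi>_def \<phi>x_def \<phi>xx_def \<phi>t_def)

lemma \<phi>_support:
  assumes "R + R\<^sup>2 < norm z" shows "\<phi> z = 0" "\<phi>x i z = 0" "\<phi>xx i z = 0" "\<phi>t z = 0"
  using \<phi>_zero[OF profile_eq_0_outside[OF R assms]] by auto

text \<open>The inverse local length of \<phi>: logarithmic derivatives blow up like
  \<open>1 / profile\<close> at the edge. The numerator is large enough that its square dominates
  the constants in the gradient, time and Laplacian bounds alike.\<close>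

definition scale :: "(real^'n) \<times> real \<Rightarrow> real" where
  "scale z = (2 * m + real CARD('n)) / (R * profile R z)"

lemma m: "m \<ge> 3" by (simp add: m_def)

context
  fixes z :: "(real^'n) \<times> real"
  assumes pos: "profile R z \<noteq> 0"
begin

lemma profile_pos: "0 < profile R z" "profile R z \<le> 1"
  using pos profile_bounds[OF R, of z] by linarith+

lemma \<phi>_pos: "\<phi> z > 0"
  using profile_pos by (simp add: \<phi>_def)

lemma scale_pos: "scale z > 0"
  unfolding scale_def using profile_pos R m by (intro divide_pos_pos mult_pos_pos add_pos_nonneg) auto

lemma scale_sq_ge:
  assumes "0 \<le> x" "x \<le> (2 * m + real CARD('n))\<^sup>2"
  shows "x / (R\<^sup>2 * (profile R z)\<^sup>2) \<le> (scale z)\<^sup>2"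
  unfolding scale_def power_divide power_mult_distrib
  using assms profile_pos R by (intro divide_right_mono) auto

lemma gradient_bound:
  "((\<Sum>i\<in>UNIV. \<phi>x i z * d i) / \<phi> z)\<^sup>2 \<le> (scale z)\<^sup>2 * (\<Sum>i\<in>UNIV. (d i)\<^sup>2)"
proof -
  define P where "P = profile R z"
  have P: "P > 0" using profile_pos by (simp add: P_def)
  have "(\<Sum>i\<in>UNIV. \<phi>x i z * d i) = m * P ^ (k + 2) * (- 2 / R\<^sup>2) * (\<Sum>i\<in>UNIV. fst z $ i * d i)"
    by (simp add: \<phi>x_def P_def sum_distrib_left mult_ac sum_divide_distrib sum_negf)
  then have "(\<Sum>i\<in>UNIV. \<phi>x i z * d i) / \<phi> z = (- 2 * m / (R\<^sup>2 * P)) * (\<Sum>i\<in>UNIV. fst z $ i * d i)"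
    using P by (simp add: \<phi>_def P_def[symmetric] power_add eval_nat_numeral field_simps)
  then have "((\<Sum>i\<in>UNIV. \<phi>x i z * d i) / \<phi> z)\<^sup>2 = (2 * m / (R\<^sup>2 * P))\<^sup>2 * (\<Sum>i\<in>UNIV. fst z $ i * d i)\<^sup>2"
    by (simp only: power_mult_distrib power_divide power2_minus mult_minus_left)
  also have "(\<Sum>i\<in>UNIV. fst z $ i * d i)\<^sup>2 \<le> (\<Sum>i\<in>UNIV. (fst z $ i)\<^sup>2) * (\<Sum>i\<in>UNIV. (d i)\<^sup>2)"
    by (rule Cauchy_Schwarz_ineq_sum)
  also have "(\<Sum>i\<in>UNIV. (fst z $ i)\<^sup>2) = fst z \<bullet> fst z" by (simp add: inner_vec_def power2_eq_square)
  also have "\<dots> * (\<Sum>i\<in>UNIV. (d i)\<^sup>2) \<le> R\<^sup>2 * (\<Sum>i\<in>UNIV. (d i)\<^sup>2)"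
    using profile_support(1)[OF R pos] by (intro mult_right_mono) (auto intro: sum_nonneg)
  finally have "((\<Sum>i\<in>UNIV. \<phi>x i z * d i) / \<phi> z)\<^sup>2 \<le> (2 * m / (R\<^sup>2 * P))\<^sup>2 * (R\<^sup>2 * (\<Sum>i\<in>UNIV. (d i)\<^sup>2))"
    by (simp add: mult_left_mono)
  also have "\<dots> = (2 * m)\<^sup>2 / (R\<^sup>2 * P\<^sup>2) * (\<Sum>i\<in>UNIV. (d i)\<^sup>2)"
    using R P by (simp add: power2_eq_square field_simps)
  also have "\<dots> \<le> (scale z)\<^sup>2 * (\<Sum>i\<in>UNIV. (d i)\<^sup>2)"
    unfolding P_def using m by (intro mult_right_mono scale_sq_ge power_mono sum_nonneg) auto
  finally show ?thesis .
qed

lemma time_bound: "\<bar>\<phi>t z / \<phi> z\<bar> \<le> (scale z)\<^sup>2"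
proof -
  define P where "P = profile R z"
  have P: "P > 0" "P \<le> 1" using profile_pos by (auto simp: P_def)
  have "\<phi>t z / \<phi> z = - 2 * m * snd z / (R ^ 4 * P)"
    using P by (simp add: \<phi>_def \<phi>t_def P_def[symmetric] power_add eval_nat_numeral field_simps)
  then have "\<bar>\<phi>t z / \<phi> z\<bar> = 2 * m * \<bar>snd z\<bar> / (R ^ 4 * P)" using R P m by (simp add: abs_mult)
  also have "\<dots> \<le> 2 * m * R\<^sup>2 / (R ^ 4 * P)"
    using profile_support(2)[OF R pos] R P m by (intro divide_right_mono mult_left_mono) auto
  also have "\<dots> = 2 * m / (R\<^sup>2 * P)" using R P by (simp add: eval_nat_numeral field_simps)
  also have "\<dots> \<le> 2 * m / (R\<^sup>2 * P\<^sup>2)"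
    using R P m by (intro divide_left_mono mult_left_mono mult_pos_pos) (auto simp: power2_eq_square mult_left_le)
  also have "\<dots> \<le> (scale z)\<^sup>2"
  proof -
    have "2 * m * 1 \<le> (2 * m + real CARD('n)) * (2 * m + real CARD('n))" using m by (intro mult_mono) auto
    then show ?thesis unfolding P_def using m by (intro scale_sq_ge) (auto simp: power2_eq_square)
  qed
  finally show ?thesis .
qed

lemma laplacian_bound: "\<bar>(\<Sum>i\<in>UNIV. \<phi>xx i z) / \<phi> z\<bar> \<le> (scale z)\<^sup>2"
proof -
  define P where "P = profile R z"
  define X where "X = fst z \<bullet> fst z"
  have P: "P > 0" "P \<le> 1" using profile_pos by (auto simp: P_def)
  have X: "0 \<le> X" "X \<le> R\<^sup>2" using profile_support(1)[OF R pos] by (auto simp: X_def)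
  have "(\<Sum>i\<in>UNIV. \<phi>xx i z) = m * (m - 1) * P ^ (k + 1) * (4 / R ^ 4) * (\<Sum>i\<in>UNIV. (fst z $ i)\<^sup>2)
      - real CARD('n) * (m * P ^ (k + 2) * (2 / R\<^sup>2))"
    by (simp add: \<phi>xx_def P_def sum.distrib sum_distrib_left power_divide power_mult_distrib
        sum_negf mult_ac sum_subtractf sum_divide_distrib flip: power_mult)
  also have "(\<Sum>i\<in>UNIV. (fst z $ i)\<^sup>2) = X" by (simp add: X_def inner_vec_def power2_eq_square)
  finally have sum: "(\<Sum>i\<in>UNIV. \<phi>xx i z) = m * (m - 1) * P ^ (k + 1) * (4 / R ^ 4) * X
      - real CARD('n) * (m * P ^ (k + 2) * (2 / R\<^sup>2))" .
  have "m * (m - 1) * P ^ (k + 1) * (4 / R ^ 4) * X / P ^ (k + 3) = 4 * (m * (m - 1)) * (X / R\<^sup>2) / (R\<^sup>2 * P\<^sup>2)"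
    using P R by (simp add: power_add eval_nat_numeral field_simps)
  moreover have "real CARD('n) * (m * P ^ (k + 2) * (2 / R\<^sup>2)) / P ^ (k + 3) = 2 * real CARD('n) * m * P / (R\<^sup>2 * P\<^sup>2)"
    using P R by (simp add: power_add eval_nat_numeral field_simps)
  ultimately have "(\<Sum>i\<in>UNIV. \<phi>xx i z) / \<phi> z
      = (4 * (m * (m - 1)) * (X / R\<^sup>2) - 2 * real CARD('n) * m * P) / (R\<^sup>2 * P\<^sup>2)"
    by (simp only: sum \<phi>_def P_def[symmetric] diff_divide_distrib)
  moreover have "\<bar>4 * (m * (m - 1)) * (X / R\<^sup>2) - 2 * real CARD('n) * m * P\<bar> \<le> (2 * m + real CARD('n))\<^sup>2"
  proof -
    have XR: "0 \<le> X / R\<^sup>2" "X / R\<^sup>2 \<le> 1" using X R by auto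
    have mm: "0 \<le> 4 * (m * (m - 1))" using m by simp
    have 1: "0 \<le> 4 * (m * (m - 1)) * (X / R\<^sup>2)" "4 * (m * (m - 1)) * (X / R\<^sup>2) \<le> 4 * (m * (m - 1))"
      using mult_nonneg_nonneg[OF mm XR(1)] mult_left_le[OF XR(2) mm] by auto
    have 2: "0 \<le> 2 * real CARD('n) * m * P" "2 * real CARD('n) * m * P \<le> 2 * real CARD('n) * m"
      using m P by (auto intro!: mult_left_le)
    have "(2 * m + real CARD('n))\<^sup>2 = 4 * (m * (m - 1)) + 4 * m + 4 * real CARD('n) * m + (real CARD('n))\<^sup>2"
      by (simp add: power2_eq_square algebra_simps)
    moreover have "0 \<le> real CARD('n) * m" "0 \<le> m * (m - 1)" using m by auto
    ultimately show ?thesis using 1 2 m zero_le_power2[of "real CARD('n)"] by linarith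
  qed
  ultimately have "\<bar>(\<Sum>i\<in>UNIV. \<phi>xx i z) / \<phi> z\<bar> \<le> (2 * m + real CARD('n))\<^sup>2 / (R\<^sup>2 * P\<^sup>2)"
    using R P by (simp add: divide_right_mono)
  also have "\<dots> \<le> (scale z)\<^sup>2" unfolding P_def by (rule scale_sq_ge) auto
  finally show ?thesis .
qed

text \<open>The factor \<phi> is the \<open>m\<close>-th power of \<open>profile\<close> and
  compensates the \<open>s\<close> negative powers contained in \<open>scale\<close>, as
  \<open>s \<le> m\<close> and \<open>profile\<close> is at most 1.\<close>

lemma scaled_power_bound:
  assumes "0 \<le> s" "s \<le> m"
  shows "\<phi> z * scale z powr s \<le> ((2 * m + real CARD('n)) / R) powr s"
proof -
  have "\<phi> z = profile R z powr m"
    unfolding m_def by (simp only: \<phi>_def powr_realpow[OF profile_pos(1)])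
  also have "\<dots> \<le> profile R z powr s" using profile_pos assms by (intro powr_mono') auto
  finally have "\<phi> z * scale z powr s \<le> profile R z powr s * scale z powr s" by (intro mult_right_mono) auto
  also have "\<dots> = (profile R z * scale z) powr s" using profile_pos scale_pos by (simp add: powr_mult)
  also have "profile R z * scale z = (2 * m + real CARD('n)) / R" using profile_pos by (simp add: scale_def)
  finally show ?thesis .
qed

end

end

section \<open>Integral identities and the energy estimate\<close>

lemma has_bochner_integral_dir_deriv:
  fixes g g' :: "'a::euclidean_space \<Rightarrow> real"
  assumes "has_dir_deriv d g g'" "continuous_on UNIV g" "continuous_on UNIV g'"
    and "\<And>z. r < norm z \<Longrightarrow> g z = 0" "\<And>z. r < norm z \<Longrightarrow> g' z = 0"
  shows "has_bochner_integral lborel g' 0"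
  using integral_dir_deriv_eq_0[OF assms(1-4)] integrable_bounded_support[OF assms(3,5)]
  by (simp add: has_bochner_integral_iff)

text \<open>The locale is applied to \<open>v = u + e\<close> with \<open>e > 0\<close>, so that negative powers of \<open>v\<close> are harmless
  without any maximum principle; the price is the error \<open>h = (u + e)\<^sup>p - u\<^sup>p\<close>.\<close>

locale positive_flow = cutoff R k index
  for R :: real and k :: nat and index :: "'n::finite itself" +
  fixes v V h :: "(real^'n) \<times> real \<Rightarrow> real" and D :: "'n \<Rightarrow> (real^'n) \<times> real \<Rightarrow> real"
    and H :: "'n \<Rightarrow> 'n \<Rightarrow> (real^'n) \<times> real \<Rightarrow> real" and p M :: real
  assumes p: "1 < p" and v_pos: "\<And>z. 0 < v z"
    and v_deriv: "\<And>i. has_dir_deriv (space_dir i) v (D i)" and v_time_deriv: "has_dir_deriv time_dir v V"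
    and D_deriv: "\<And>i j. has_dir_deriv (space_dir j) (D i) (H i j)"
    and cont: "continuous_on UNIV v" "continuous_on UNIV V" "continuous_on UNIV h"
      "\<And>i. continuous_on UNIV (D i)" "\<And>i j. continuous_on UNIV (H i j)"
    and equation: "\<And>z. V z - (\<Sum>i\<in>UNIV. H i i z)
        = v z powr p + M * sqrt (\<Sum>i\<in>UNIV. (D i z)\<^sup>2) powr (2 * p / (p + 1)) - h z"
begin

definition "L z = (\<Sum>i\<in>UNIV. H i i z)"
definition "G z = (\<Sum>i\<in>UNIV. (D i z)\<^sup>2)"
definition "w z = v z powr p"
definition "B z = (\<Sum>i\<in>UNIV. \<phi>x i z * D i z)"
definition "\<Delta>\<phi> z = (\<Sum>i\<in>UNIV. \<phi>xx i z)"

text \<open>Formally, \<open>XA\<close> is the divergence of \<open>\<phi> * (L \<nabla>v - D^2v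
  \<nabla>v) + |\<nabla>v|^2 \<nabla>\<phi> / 2\<close>, and \<open>XB\<close> that of
  \<open>\<phi> |\<nabla>v|^2 \<nabla>v / v\<close>. Likewise \<open>XT\<close> is the divergence of
  \<open>\<phi> V \<nabla>v\<close> minus the time derivative of
  \<open>\<phi> |\<nabla>v|^2 / 2\<close>, \<open>XP\<close> the divergence of
  \<open>\<phi> w \<nabla>v\<close>, and \<open>XQ\<close> the time derivative of
  \<open>\<phi> w v / (p + 1)\<close>.\<close>

definition "XA z = \<phi> z * ((L z)\<^sup>2 - (\<Sum>i\<in>UNIV. \<Sum>j\<in>UNIV. (H i j z)\<^sup>2)) + L z * B z + G z * \<Delta>\<phi> z / 2"
definition "XB z = 2 * (\<phi> z / v z) * (\<Sum>i\<in>UNIV. \<Sum>j\<in>UNIV. H i j z * D i z * D j z)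
  + G z * (B z / v z - \<phi> z * G z / (v z)\<^sup>2 + \<phi> z * L z / v z)"
definition "XT z = \<phi> z * L z * V z + V z * B z - \<phi>t z * G z / 2"
definition "XP z = \<phi> z * w z * L z + w z * B z + p * \<phi> z * w z * (G z / v z)"
definition "XQ z = \<phi> z * w z * V z + \<phi>t z * (w z * v z) / (p + 1)"

lemma H_sym: "H i j z = H j i z"
  by (rule mixed_dir_derivs_eq[OF v_deriv D_deriv v_deriv D_deriv cont(5) cont(5)])

lemma v_nonzero: "v z \<noteq> 0" using v_pos[of z] by simp

lemma cont_w: "continuous_on UNIV w"
  unfolding w_def[abs_def] using v_nonzero by (intro continuous_on_powr continuous_intros cont) auto

lemma cont_inverse: "continuous_on UNIV (\<lambda>z. inverse (v z))"
  using v_nonzero by (intro continuous_on_inverse cont) auto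

lemma w_deriv: "has_dir_deriv d v v' \<Longrightarrow> has_dir_deriv d w (\<lambda>z. p * v z powr (p - 1) * v' z)"
  unfolding w_def[abs_def] using v_pos by (intro has_dir_deriv_chain has_real_derivative_powr)

lemma inverse_deriv: "has_dir_deriv d v v' \<Longrightarrow> has_dir_deriv d (\<lambda>z. inverse (v z)) (\<lambda>z. - (inverse (v z) ^ Suc (Suc 0)) * v' z)"
  using v_nonzero by (intro has_dir_deriv_chain DERIV_inverse)

lemma powr_minus_one: "v z powr (p - 1) = w z / v z"
  unfolding w_def using v_pos[of z] by (simp add: powr_diff)

lemma cont_powr_minus_one: "continuous_on UNIV (\<lambda>z. v z powr (p - 1))"
  using v_nonzero by (intro continuous_on_powr continuous_intros cont) auto

lemma null_XA: "has_bochner_integral lborel XA 0"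
proof -
  have 1: "has_bochner_integral lborel (\<lambda>z. \<phi> z * (H i i z * H j j z - (H i j z)\<^sup>2)
      + \<phi>x i z * D i z * H j j z - \<phi>x j z * D i z * H i j z) 0" for i j
  proof -
    \<comment> \<open>The Hessian identity expects one function for both mixed derivatives.\<close>
    have HH: "H j i = H i j" using H_sym by (intro ext)
    have "integrable lborel (\<lambda>z. \<phi> z * (H i i z * H j j z - (H i j z)\<^sup>2)
      + \<phi>x i z * D i z * H j j z - \<phi>x j z * D i z * H i j z)"
      by (rule integrable_bounded_support[of _ "R + R\<^sup>2"])
         (auto intro!: continuous_intros cont \<phi>_continuous simp: \<phi>_support)
    moreover have "(\<integral>z. \<phi> z * (H i i z * H j j z - (H i j z)\<^sup>2)
      + \<phi>x i z * D i z * H j j z - \<phi>x j z * D i z * H i j z \<partial>lborel) = 0"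
      using integral_hessian_identity[OF \<phi>_derivs(1) \<phi>_derivs(1) D_deriv D_deriv D_deriv D_deriv[of i j, unfolded HH]
          \<phi>_continuous(1,2,2) cont(4,5,5,4,5) \<phi>_support(1,2,2)] by blast
    ultimately show ?thesis by (simp add: has_bochner_integral_iff)
  qed
  \<comment> \<open>Half of this divergence cancels the terms
    \<open>\<phi>x j z * D i z * H i j z\<close> left over in \<open>1\<close> and contributes the
    Laplacian of \<phi>.\<close>
  have 2: "has_bochner_integral lborel (\<lambda>z. \<phi>xx j z * (D i z * D i z) + \<phi>x j z * (H i j z * D i z + D i z * H i j z)) 0" for i j
    by (rule has_bochner_integral_dir_deriv[where g = "\<lambda>z. \<phi>x j z * (D i z * D i z)" and r = "R + R\<^sup>2" and d = "space_dir j"],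
        (intro has_dir_deriv_mult D_deriv \<phi>_derivs)[1])
       (auto intro!: continuous_intros cont \<phi>_continuous simp: \<phi>_support)
  have "has_bochner_integral lborel (\<lambda>z. \<Sum>i\<in>UNIV. \<Sum>j\<in>UNIV. (\<phi> z * (H i i z * H j j z - (H i j z)\<^sup>2)
      + \<phi>x i z * D i z * H j j z - \<phi>x j z * D i z * H i j z)
      + 1 / 2 * (\<phi>xx j z * (D i z * D i z) + \<phi>x j z * (H i j z * D i z + D i z * H i j z)))
      (\<Sum>i\<in>(UNIV::'n set). \<Sum>j\<in>(UNIV::'n set). 0 + 1 / 2 * 0)"
    by (intro has_bochner_integral_sum has_bochner_integral_add 1 has_bochner_integral_mult_right impI 2)
  moreover have "(\<Sum>i\<in>UNIV. \<Sum>j\<in>UNIV. (\<phi> z * (H i i z * H j j z - (H i j z)\<^sup>2)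
      + \<phi>x i z * D i z * H j j z - \<phi>x j z * D i z * H i j z)
      + 1 / 2 * (\<phi>xx j z * (D i z * D i z) + \<phi>x j z * (H i j z * D i z + D i z * H i j z))) = XA z" for z
  proof -
    have LL: "(L z)\<^sup>2 = (\<Sum>i\<in>UNIV. \<Sum>j\<in>UNIV. H i i z * H j j z)"
      by (simp add: L_def power2_eq_square sum_product)
    have BL: "L z * B z = (\<Sum>i\<in>UNIV. \<Sum>j\<in>UNIV. \<phi>x i z * D i z * H j j z)"
      by (subst mult.commute) (simp add: L_def B_def sum_product)
    have GD: "G z * \<Delta>\<phi> z / 2 = (\<Sum>i\<in>UNIV. \<Sum>j\<in>UNIV. (D i z)\<^sup>2 * \<phi>xx j z / 2)"
      by (simp add: G_def \<Delta>\<phi>_def sum_product sum_divide_distrib)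
    show ?thesis
      unfolding XA_def LL BL GD
      by (simp add: sum_distrib_left flip: sum.distrib sum_subtractf)
         (intro sum.cong refl; simp add: power2_eq_square algebra_simps)
  qed
  ultimately show ?thesis by simp
qed

lemma null_XB: "has_bochner_integral lborel XB 0"
proof -
  have 1: "has_bochner_integral lborel (\<lambda>z. ((\<phi>x j z * inverse (v z) + \<phi> z * (- (inverse (v z) ^ Suc (Suc 0)) * D j z)) * D j z
      + (\<phi> z * inverse (v z)) * H j j z) * (D i z * D i z)
      + (\<phi> z * inverse (v z) * D j z) * (H i j z * D i z + D i z * H i j z)) 0" for i j
    by (rule has_bochner_integral_dir_deriv[where g = "\<lambda>z. \<phi> z * inverse (v z) * D j z * (D i z * D i z)"
          and r = "R + R\<^sup>2" and d = "space_dir j"],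
        (intro has_dir_deriv_mult D_deriv inverse_deriv v_deriv \<phi>_derivs)[1])
       (auto intro!: continuous_intros cont cont_inverse \<phi>_continuous
         simp: \<phi>_support simp del: power_Suc)
  have "has_bochner_integral lborel (\<lambda>z. \<Sum>i\<in>UNIV. \<Sum>j\<in>UNIV. ((\<phi>x j z * inverse (v z) + \<phi> z * (- (inverse (v z) ^ Suc (Suc 0)) * D j z)) * D j z
      + (\<phi> z * inverse (v z)) * H j j z) * (D i z * D i z)
      + (\<phi> z * inverse (v z) * D j z) * (H i j z * D i z + D i z * H i j z))
      (\<Sum>i\<in>(UNIV::'n set). \<Sum>j\<in>(UNIV::'n set). 0)"
    by (intro has_bochner_integral_sum 1)
  moreover have "(\<Sum>i\<in>UNIV. \<Sum>j\<in>UNIV. ((\<phi>x j z * inverse (v z) + \<phi> z * (- (inverse (v z) ^ Suc (Suc 0)) * D j z)) * D j z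
      + (\<phi> z * inverse (v z)) * H j j z) * (D i z * D i z)
      + (\<phi> z * inverse (v z) * D j z) * (H i j z * D i z + D i z * H i j z)) = XB z" for z
  proof -
    have B: "B z / v z - \<phi> z * G z / (v z)\<^sup>2 + \<phi> z * L z / v z
      = (\<Sum>j\<in>UNIV. \<phi>x j z * D j z / v z - \<phi> z * (D j z)\<^sup>2 / (v z)\<^sup>2 + \<phi> z * H j j z / v z)"
      by (simp add: B_def G_def L_def sum.distrib sum_subtractf sum_divide_distrib sum_distrib_left)
    show ?thesis
      unfolding XB_def B unfolding G_def sum_product
      by (simp add: sum_distrib_left flip: sum.distrib)
         (intro sum.cong refl; simp add: power2_eq_square algebra_simps divide_inverse)
  qed
  ultimately show ?thesis by simp
qed

lemma null_XT: "has_bochner_integral lborel XT 0"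
proof -
  have 1: "has_bochner_integral lborel (\<lambda>z. \<phi> z * H i i z * V z + \<phi>x i z * D i z * V z - \<phi>t z * (D i z)\<^sup>2 / 2) 0" for i
  proof -
    have "integrable lborel (\<lambda>z. \<phi> z * H i i z * V z + \<phi>x i z * D i z * V z - \<phi>t z * (D i z)\<^sup>2 / 2)"
      by (rule integrable_bounded_support[of _ "R + R\<^sup>2"])
         (auto intro!: continuous_intros cont \<phi>_continuous simp: \<phi>_support)
    moreover have "(\<integral>z. \<phi> z * H i i z * V z + \<phi>x i z * D i z * V z - \<phi>t z * (D i z)\<^sup>2 / 2 \<partial>lborel) = 0"
      using integral_energy_identity[OF \<phi>_derivs(1,3) v_deriv D_deriv v_time_deriv \<phi>_continuous(1,2,4) cont(1,4,5,2)
         \<phi>_support(1,2,4)] by blast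
    ultimately show ?thesis by (simp add: has_bochner_integral_iff)
  qed
  have "has_bochner_integral lborel (\<lambda>z. \<Sum>i\<in>UNIV. \<phi> z * H i i z * V z + \<phi>x i z * D i z * V z - \<phi>t z * (D i z)\<^sup>2 / 2)
      (\<Sum>i\<in>(UNIV::'n set). 0)"
    by (intro has_bochner_integral_sum 1)
  moreover have "(\<Sum>i\<in>UNIV. \<phi> z * H i i z * V z + \<phi>x i z * D i z * V z - \<phi>t z * (D i z)\<^sup>2 / 2) = XT z" for z
    by (simp add: XT_def L_def B_def G_def sum_subtractf sum.distrib sum_distrib_left sum_distrib_right sum_divide_distrib mult_ac)
  ultimately show ?thesis by simp
qed

lemma null_XP: "has_bochner_integral lborel XP 0"
proof -
  have 1: "has_bochner_integral lborel (\<lambda>z. (\<phi>x i z * w z + \<phi> z * (p * v z powr (p - 1) * D i z)) * D i z + \<phi> z * w z * H i i z) 0" for i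
    by (rule has_bochner_integral_dir_deriv[where g = "\<lambda>z. \<phi> z * w z * D i z" and r = "R + R\<^sup>2" and d = "space_dir i"])
       (auto intro!: has_dir_deriv_mult D_deriv w_deriv[OF v_deriv] \<phi>_derivs continuous_intros cont cont_w cont_powr_minus_one \<phi>_continuous
         simp: \<phi>_support)
  have "has_bochner_integral lborel (\<lambda>z. \<Sum>i\<in>UNIV. (\<phi>x i z * w z + \<phi> z * (p * v z powr (p - 1) * D i z)) * D i z + \<phi> z * w z * H i i z)
      (\<Sum>i\<in>(UNIV::'n set). 0)"
    by (intro has_bochner_integral_sum 1)
  moreover have "(\<Sum>i\<in>UNIV. (\<phi>x i z * w z + \<phi> z * (p * v z powr (p - 1) * D i z)) * D i z + \<phi> z * w z * H i i z) = XP z" for z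
    unfolding powr_minus_one
    by (simp add: XP_def L_def B_def G_def sum.distrib sum_distrib_left sum_distrib_right sum_divide_distrib
        distrib_right distrib_left power2_eq_square mult_ac)
  ultimately show ?thesis by simp
qed

lemma null_XQ: "has_bochner_integral lborel XQ 0"
proof -
  have "has_bochner_integral lborel (\<lambda>z. \<phi>t z * (w z * v z) + \<phi> z * ((p * v z powr (p - 1) * V z) * v z + w z * V z)) 0"
    by (rule has_bochner_integral_dir_deriv[where g = "\<lambda>z. \<phi> z * (w z * v z)" and r = "R + R\<^sup>2" and d = time_dir])
       (auto intro!: has_dir_deriv_mult w_deriv[OF v_time_deriv] v_time_deriv \<phi>_derivs continuous_intros cont cont_w cont_powr_minus_one \<phi>_continuous
         simp: \<phi>_support)
  then have "has_bochner_integral lborel (\<lambda>z. (1 / (p + 1)) * (\<phi>t z * (w z * v z) + \<phi> z * ((p * v z powr (p - 1) * V z) * v z + w z * V z)))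
     ((1 / (p + 1)) * 0)"
    by (intro has_bochner_integral_mult_right impI)
  moreover have "(1 / (p + 1)) * (\<phi>t z * (w z * v z) + \<phi> z * ((p * v z powr (p - 1) * V z) * v z + w z * V z)) = XQ z" for z
    unfolding powr_minus_one XQ_def using p v_nonzero[of z] by (simp add: field_simps)
  ultimately show ?thesis by simp
qed

end

section \<open>The pointwise bound and its integral over the parabolic cylinder\<close>

lemma (in cutoff) profile_support_box:
  assumes "profile R z \<noteq> 0"
  shows "(z :: (real^'n) \<times> real) \<in> cbox (\<chi> i. - R, - (R\<^sup>2)) (\<chi> i. R, R\<^sup>2)"
proof -
  have "\<bar>fst z $ i\<bar> \<le> R" for i
  proof -
    have "(fst z $ i)\<^sup>2 \<le> (\<Sum>i\<in>UNIV. (fst z $ i)\<^sup>2)"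
      by (rule member_le_sum) auto
    also have "\<dots> = fst z \<bullet> fst z" by (simp add: inner_vec_def power2_eq_square)
    also have "\<dots> \<le> R\<^sup>2" using profile_support[OF R assms] by simp
    finally show ?thesis using R by (simp add: power2_le_iff_abs_le)
  qed
  then have "fst z \<in> cbox (\<chi> i. - R) (\<chi> i. R)" by (simp add: mem_box_cart abs_le_iff minus_le_iff)
  moreover have "- (R\<^sup>2) \<le> snd z" "snd z \<le> R\<^sup>2" using profile_support(2)[OF R assms] by auto
  ultimately have "(fst z, snd z) \<in> cbox (\<chi> i. - R, - (R\<^sup>2)) (\<chi> i. R, R\<^sup>2)"
    unfolding cbox_Pair_eq by (simp add: mem_Times_iff)
  then show ?thesis by simp
qed

lemma measure_parabolic_box:
  assumes "R > 0"
  shows "measure lborel (cbox (\<chi> i. - R, - (R\<^sup>2)) (\<chi> i. R, R\<^sup>2) :: ((real^'n::finite) \<times> real) set)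
    = (2 * R) ^ CARD('n) * (2 * R\<^sup>2)"
proof -
  have ne: "cbox (\<chi> i. - R) (\<chi> i. R) \<noteq> ({} :: (real^'n) set)"
    using assms by (auto simp: interval_ne_empty_cart)
  have "measure lborel (cbox (\<chi> i. - R) (\<chi> i. R) :: (real^'n) set) = (2 * R) ^ CARD('n)"
    using content_cbox_cart[OF ne] by simp
  then show ?thesis by (simp add: content_Pair)
qed

context positive_flow
begin

text \<open>The trace inequality with \<open>k = \<kappa> / v\<close>, divided by \<phi>, supplies
  the main hypothesis of \<open>absorbing\<close>; multiplying its conclusion by \<phi> turns the
  correction terms into \<open>XT\<close>, \<open>XP\<close>, \<open>XQ\<close>, \<open>XA\<close>
  and \<open>XB\<close>. Where \<phi> vanishes these terms vanish as well.\<close>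

lemma pointwise_bound:
  assumes ab: "absorbing p \<alpha> \<nu> \<mu> \<kappa> \<epsilon> C cT cP cQ cY" and C: "0 \<le> C"
    and \<nu>: "\<nu> = 1 - 1 / real CARD('n)" and \<mu>: "\<mu> = \<kappa> * (1 + 2 / real CARD('n))" and \<alpha>: "\<alpha> = \<kappa> - \<kappa>\<^sup>2 * \<nu>"
    and M: "0 < M" "M < \<epsilon>" and s: "4 * p / (p - 1) \<le> m"
  shows "\<phi> z * (w z)\<^sup>2 \<le> C * (((2 * m + real CARD('n)) / R) powr (4 * p / (p - 1))
        * indicator (cbox (\<chi> i. - R, - (R\<^sup>2)) (\<chi> i. R, R\<^sup>2)) z + \<phi> z * (h z)\<^sup>2)
      + cT * XT z + cP * XP z + cQ * XQ z + cY * (XA z + \<kappa> * XB z)"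
proof (cases "profile R z = 0")
  case True
  have "B z = 0" "\<Delta>\<phi> z = 0" by (simp_all add: B_def \<Delta>\<phi>_def \<phi>_zero[OF True])
  then show ?thesis using C
    by (simp add: XA_def XB_def XT_def XP_def XQ_def \<phi>_zero[OF True])
next
  case False
  define K where "K = ((2 * m + real CARD('n)) / R) powr (4 * p / (p - 1))"
  define f where "f = \<phi> z"
  have f: "f > 0" using \<phi>_pos[OF False] by (simp add: f_def)
  define a where "a = G z / v z"
  define b where "b = B z / f"
  define \<tau> where "\<tau> = \<phi>t z / f"
  define \<sigma> where "\<sigma> = \<Delta>\<phi> z / f"
  define g where "g = M * sqrt (G z) powr (2 * p / (p + 1))"
  define y where "y = (XA z + \<kappa> * XB z) / f"
  define S where "S = (\<Sum>i\<in>UNIV. \<Sum>j\<in>UNIV. (H i j z)\<^sup>2)"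
  define S' where "S' = (\<Sum>i\<in>UNIV. \<Sum>j\<in>UNIV. H i j z * D i z * D j z)"
  have v: "v z > 0" by (rule v_pos)
  have G: "G z \<ge> 0" by (simp add: G_def sum_nonneg)
  have av: "a * v z = G z" using v by (simp add: a_def)
  have a: "a \<ge> 0" using G v by (simp add: a_def)
  have s0: "0 \<le> 4 * p / (p - 1)" using p by simp
  have eqs: "B z = f * b" "\<phi>t z = f * \<tau>" "\<Delta>\<phi> z = f * \<sigma>" "XA z + \<kappa> * XB z = f * y"
    using f by (auto simp: b_def \<tau>_def \<sigma>_def y_def)
  have g2: "g\<^sup>2 \<le> M\<^sup>2 * (a\<^sup>2 + (v z powr p)\<^sup>2)"
    unfolding g_def power_mult_distrib using gradient_power_bound[OF p a v] by (simp add: av mult_left_mono)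
  have b2: "b\<^sup>2 \<le> (scale z)\<^sup>2 * (a * v z)"
    using gradient_bound[OF False, of "\<lambda>i. D i z"] by (simp add: b_def f_def av G_def B_def)
  have Leq: "L z = V z - v z powr p - g + h z"
    using equation[of z] by (simp add: L_def g_def G_def)
  have main: "\<alpha> * a\<^sup>2 \<le> \<nu> * (L z)\<^sup>2 + \<mu> * (a * L z) + L z * b + a * v z * \<sigma> / 2 + \<kappa> * (a * b) - y"
  proof -
    define \<iota> where "\<iota> = 1 / real CARD('n)"
    have "(L z - (\<kappa> / v z) * G z)\<^sup>2 / real CARD('n) \<le> S - 2 * (\<kappa> / v z) * S' + (\<kappa> / v z)\<^sup>2 * (G z)\<^sup>2"
      unfolding L_def G_def S_def S'_def by (rule trace_square_le)
    moreover have "(\<kappa> / v z) * G z = \<kappa> * a" "(\<kappa> / v z)\<^sup>2 * (G z)\<^sup>2 = \<kappa>\<^sup>2 * a\<^sup>2"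
      by (simp_all add: a_def power_divide)
    ultimately have 1: "(L z - \<kappa> * a)\<^sup>2 * \<iota> \<le> S - 2 * \<kappa> * (S' / v z) + \<kappa>\<^sup>2 * a\<^sup>2"
      by (simp add: \<iota>_def)
    have "XA z = f * ((L z)\<^sup>2 - S + L z * b + a * v z * \<sigma> / 2)"
      unfolding XA_def eqs f_def[symmetric] S_def[symmetric] av by (simp add: algebra_simps)
    moreover have "XB z = f * (2 * (S' / v z) + a * b - a\<^sup>2 + a * L z)"
      unfolding XB_def eqs f_def[symmetric] S'_def[symmetric] by (simp add: a_def algebra_simps power2_eq_square)
    ultimately have "f * y = f * ((L z)\<^sup>2 - S + L z * b + a * v z * \<sigma> / 2 + \<kappa> * (2 * (S' / v z) + a * b - a\<^sup>2 + a * L z))"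
      unfolding eqs(4)[symmetric] by (simp only: distrib_left mult.left_commute[of f])
    then have y: "y = (L z)\<^sup>2 - S + L z * b + a * v z * \<sigma> / 2 + \<kappa> * (2 * (S' / v z) + a * b - a\<^sup>2 + a * L z)"
      using f by simp
    \<comment> \<open>In \<open>y\<close> the Hessian enters, apart from \<open>L\<close>, only
      through \<open>S - 2 * \<kappa> * (S' / v z)\<close>, which \<open>1\<close> bounds from
      below. Expanding \<open>(L z - \<kappa> * a)^2 * \<iota>\<close> and collecting
      \<open>L^2\<close>, \<open>a * L\<close> and \<open>a^2\<close> gives exactly \<nu>, \<mu> and
      \<alpha>.\<close>
    have \<nu>': "\<nu> = 1 - \<iota>" and \<mu>': "\<mu> = \<kappa> * (1 + 2 * \<iota>)" by (simp_all add: \<nu> \<mu> \<iota>_def)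
    then show ?thesis using 1 unfolding y \<alpha> \<mu>' \<nu>' by (simp add: algebra_simps power2_eq_square)
  qed
  have "(v z powr p)\<^sup>2 \<le> C * (scale z powr (4 * p / (p - 1)) + (h z)\<^sup>2) + cT * (L z * V z + V z * b - \<tau> * (a * v z) / 2)
      + cP * (v z powr p * L z + v z powr p * b + p * v z powr p * a)
      + cQ * (v z powr p * V z + \<tau> * (v z powr p * v z) / (p + 1)) + cY * y"
  proof -
    have "0 \<le> g" using M by (simp add: g_def)
    moreover have "\<bar>\<tau>\<bar> \<le> (scale z)\<^sup>2" "\<bar>\<sigma>\<bar> \<le> (scale z)\<^sup>2"
      using time_bound[OF False] laplacian_bound[OF False] by (simp_all only: \<tau>_def \<sigma>_def f_def \<Delta>\<phi>_def)
    ultimately show ?thesis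
      using ab[unfolded absorbing_def, rule_format, OF M a v scale_pos[OF False] _ g2 b2 _ _ Leq main] by blast
  qed
  then have "f * (w z)\<^sup>2 \<le> f * (C * (scale z powr (4 * p / (p - 1)) + (h z)\<^sup>2) + cT * (L z * V z + V z * b - \<tau> * (a * v z) / 2)
      + cP * (w z * L z + w z * b + p * w z * a)
      + cQ * (w z * V z + \<tau> * (w z * v z) / (p + 1)) + cY * y)"
    using f by (simp add: w_def)
  also have "\<dots> = C * (f * scale z powr (4 * p / (p - 1)) + f * (h z)\<^sup>2) + cT * (f * (L z * V z + V z * b - \<tau> * (a * v z) / 2))
      + cP * (f * (w z * L z + w z * b + p * w z * a))
      + cQ * (f * (w z * V z + \<tau> * (w z * v z) / (p + 1))) + cY * (f * y)"
    by (simp only: distrib_left mult.left_commute[of f])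
  also have "f * (L z * V z + V z * b - \<tau> * (a * v z) / 2) = XT z"
    unfolding XT_def eqs av f_def[symmetric] by (simp add: algebra_simps)
  also have "f * (w z * L z + w z * b + p * w z * a) = XP z"
    unfolding XP_def eqs a_def f_def[symmetric] by (simp add: algebra_simps)
  also have "f * (w z * V z + \<tau> * (w z * v z) / (p + 1)) = XQ z"
    unfolding XQ_def eqs f_def[symmetric] by (simp add: algebra_simps)
  also have "f * y = XA z + \<kappa> * XB z" by (simp only: eqs)
  also have "C * (f * scale z powr (4 * p / (p - 1)) + f * (h z)\<^sup>2)
    \<le> C * (K * indicator (cbox (\<chi> i. - R, - (R\<^sup>2)) (\<chi> i. R, R\<^sup>2)) z + f * (h z)\<^sup>2)"
    using scaled_power_bound[OF False s0 s] profile_support_box[OF False] C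
    by (intro mult_left_mono add_right_mono) (auto simp: K_def f_def)
  finally show ?thesis by (simp add: K_def f_def)
qed

text \<open>The null expressions disappear on integration whatever the signs of \<open>cT\<close>,
  \<open>cP\<close>, \<open>cQ\<close>, \<open>cY\<close>, leaving the box volume and the error from
  \<open>h\<close>.\<close>

lemma energy_bound:
  assumes ab: "absorbing p \<alpha> \<nu> \<mu> \<kappa> \<epsilon> C cT cP cQ cY" and C: "0 \<le> C"
    and \<nu>: "\<nu> = 1 - 1 / real CARD('n)" and \<mu>: "\<mu> = \<kappa> * (1 + 2 / real CARD('n))" and \<alpha>: "\<alpha> = \<kappa> - \<kappa>\<^sup>2 * \<nu>"
    and M: "0 < M" "M < \<epsilon>" and s: "4 * p / (p - 1) \<le> m"
  shows "(\<integral>z. \<phi> z * (v z powr p)\<^sup>2 \<partial>lborel) \<le> C * (((2 * m + real CARD('n)) / R) powr (4 * p / (p - 1))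
        * ((2 * R) ^ CARD('n) * (2 * R\<^sup>2)) + (\<integral>z. \<phi> z * (h z)\<^sup>2 \<partial>lborel))"
proof -
  define X :: "((real^'n) \<times> real) set" where "X = cbox (\<chi> i. - R, - (R\<^sup>2)) (\<chi> i. R, R\<^sup>2)"
  define K where "K = ((2 * m + real CARD('n)) / R) powr (4 * p / (p - 1))"
  have iw: "integrable lborel (\<lambda>z. \<phi> z * (w z)\<^sup>2)" and ih: "integrable lborel (\<lambda>z. \<phi> z * (h z)\<^sup>2)"
    by (rule integrable_bounded_support[of _ "R + R\<^sup>2"];
        auto intro!: continuous_intros cont_w cont \<phi>_continuous simp: \<phi>_support)+
  have "has_bochner_integral lborel (\<lambda>z. indicator X z *\<^sub>R (1::real)) (measure lborel X *\<^sub>R 1)"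
    unfolding X_def by (rule has_bochner_integral_indicator) (auto simp: emeasure_lborel_cbox_finite[unfolded infinity_ennreal_def])
  then have iX: "has_bochner_integral lborel (indicator X) (measure lborel X)" by simp
  have rhs: "has_bochner_integral lborel
     (\<lambda>z. C * (K * indicator X z + \<phi> z * (h z)\<^sup>2) + cT * XT z + cP * XP z + cQ * XQ z + cY * (XA z + \<kappa> * XB z))
     (C * (K * measure lborel X + (\<integral>z. \<phi> z * (h z)\<^sup>2 \<partial>lborel)) + cT * 0 + cP * 0 + cQ * 0 + cY * (0 + \<kappa> * 0))"
    by (intro has_bochner_integral_add has_bochner_integral_mult_right impI null_XT null_XP null_XQ null_XA null_XB iX
        has_bochner_integral_integrable ih)
  have "(\<integral>z. \<phi> z * (w z)\<^sup>2 \<partial>lborel) \<le> C * (K * measure lborel X + (\<integral>z. \<phi> z * (h z)\<^sup>2 \<partial>lborel))"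
    using integral_mono[OF iw, of "\<lambda>z. C * (K * indicator X z + \<phi> z * (h z)\<^sup>2) + cT * XT z + cP * XP z + cQ * XQ z + cY * (XA z + \<kappa> * XB z)"]
      rhs pointwise_bound[OF assms] unfolding has_bochner_integral_iff X_def[symmetric] K_def[symmetric] by simp
  then show ?thesis unfolding w_def K_def X_def measure_parabolic_box[OF R] .
qed

end

section \<open>Entire solutions\<close>

text \<open>The last two conclusions express \<open>\<alpha> > 0\<close> and
  \<open>\<nu> * p < \<mu>\<close> for the coefficients of the Bochner inequality. In dimension one
  \<nu> is zero, so \<kappa> is unrestricted from above.\<close>

lemma kappa_exists:
  assumes "1 < p" "ereal p < p_B N" "1 \<le> N"
  obtains \<kappa> where "0 < \<kappa>" "\<kappa> * (1 - 1 / real N) < 1" "(1 - 1 / real N) * p < \<kappa> * (1 + 2 / real N)"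
proof (cases "N = 1")
  case True
  then show ?thesis using that[of 1] by simp
next
  case False
  define n where "n = real N"
  have n: "n \<ge> 2" using False assms(3) by (simp add: n_def)
  have "p < n * (n + 2) / (n - 1)\<^sup>2"
    using assms(2) False assms(3) by (simp add: p_B_def n_def)
  then have "p * (n - 1)\<^sup>2 < n * (n + 2)" using n by (simp add: pos_less_divide_eq)
  then have "p * (n - 1) * (n - 1) < n * (n + 2)" by (simp add: power2_eq_square)
  then have "(n - 1) * p / (n + 2) < n / (n - 1)"
    using n by (simp add: field_simps)
  then obtain \<kappa> where k: "(n - 1) * p / (n + 2) < \<kappa>" "\<kappa> < n / (n - 1)" using dense by blast
  have "0 \<le> (n - 1) * p / (n + 2)" using n assms(1) by simp
  then have "0 < \<kappa>" using k by linarith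
  moreover have "\<kappa> * (1 - 1 / n) < 1" using k(2) n by (simp add: field_simps)
  moreover have "(1 - 1 / n) * p < \<kappa> * (1 + 2 / n)"
  proof -
    have "(n - 1) * p < \<kappa> * (n + 2)" using k(1) n by (simp add: pos_divide_less_eq)
    then have "(n - 1) * p / n < \<kappa> * (n + 2) / n" using n by (intro divide_strict_right_mono) auto
    moreover have "(n - 1) * p / n = (1 - 1 / n) * p" "\<kappa> * (n + 2) / n = \<kappa> * (1 + 2 / n)"
      using n by (simp_all add: field_simps)
    ultimately show ?thesis by simp
  qed
  ultimately show ?thesis using that unfolding n_def by blast
qed

text \<open>Equivalent to the Sobolev condition \<open>p * (N - 2) < N + 2\<close>. For
  \<open>N > 2\<close> it follows from \<open>p < p_B N\<close>, because
  \<open>N * (N - 2) \<le> (N - 1)^2\<close>.\<close>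

lemma decay_exponent_neg:
  assumes "1 < p" "ereal p < p_B N" "1 \<le> N"
  shows "real N + 2 < 4 * p / (p - 1)"
proof -
  define n where "n = real N"
  have "p * (n - 2) < n + 2"
  proof (cases "N \<le> 2")
    case True
    then have "p * (n - 2) \<le> 0" using assms(1) by (intro mult_nonneg_nonpos) (auto simp: n_def)
    then show ?thesis by (simp add: n_def)
  next
    case False
    then have n: "n > 2" by (simp add: n_def)
    have "p < n * (n + 2) / (n - 1)\<^sup>2"
      using assms(2) False by (simp add: p_B_def n_def)
    then have "p * (n - 1)\<^sup>2 < n * (n + 2)" using n by (simp add: pos_less_divide_eq)
    then have "p * (n - 1)\<^sup>2 * (n - 2) < n * (n + 2) * (n - 2)" using n by simp
    also have "\<dots> = (n * (n - 2)) * (n + 2)" by simp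
    also have "\<dots> \<le> (n - 1)\<^sup>2 * (n + 2)" using n by (intro mult_right_mono) (auto simp: power2_eq_square algebra_simps)
    finally have "(n - 1)\<^sup>2 * (p * (n - 2)) < (n - 1)\<^sup>2 * (n + 2)" by (simp add: mult_ac)
    then show ?thesis using n by (simp add: mult_less_cancel_left)
  qed
  then show ?thesis using assms(1) by (simp add: n_def field_simps)
qed

section \<open>From classical solutions to shifted positive flows\<close>

lemma C21_imp_has_dir_deriv:
  assumes "C21 u"
  shows "has_dir_deriv (space_dir i) (\<lambda>z. u (fst z) (snd z)) (\<lambda>z. partial i (\<lambda>y. u y (snd z)) (fst z))"
    and "has_dir_deriv (space_dir j) (\<lambda>z. partial i (\<lambda>y. u y (snd z)) (fst z))
      (\<lambda>z. partial j (partial i (\<lambda>y. u y (snd z))) (fst z))"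
    and "has_dir_deriv time_dir (\<lambda>z. u (fst z) (snd z)) (\<lambda>z. deriv (u (fst z)) (snd z))"
proof -
  show "has_dir_deriv (space_dir i) (\<lambda>z. u (fst z) (snd z)) (\<lambda>z. partial i (\<lambda>y. u y (snd z)) (fst z))"
    using assms unfolding C21_def has_dir_deriv_def partial_def has_partial_def
    by (simp add: DERIV_deriv_iff_field_differentiable)
  show "has_dir_deriv (space_dir j) (\<lambda>z. partial i (\<lambda>y. u y (snd z)) (fst z))
      (\<lambda>z. partial j (partial i (\<lambda>y. u y (snd z))) (fst z))"
    using assms unfolding C21_def has_dir_deriv_def partial_def[of j] has_partial_def
    by (simp add: DERIV_deriv_iff_field_differentiable)
  show "has_dir_deriv time_dir (\<lambda>z. u (fst z) (snd z)) (\<lambda>z. deriv (u (fst z)) (snd z))"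
    unfolding has_dir_deriv_def
  proof
    fix z :: "(real^'a) \<times> real"
    have "(u (fst z) has_real_derivative deriv (u (fst z)) (snd z)) (at (snd z))"
      using assms by (simp add: C21_def DERIV_deriv_iff_field_differentiable)
    then show "((\<lambda>s. u (fst (z + s *\<^sub>R time_dir)) (snd (z + s *\<^sub>R time_dir))) has_real_derivative deriv (u (fst z)) (snd z)) (at 0)"
      using DERIV_shift[of "u (fst z)" "deriv (u (fst z)) (snd z)" 0 "snd z"] by (simp add: add.commute)
  qed
qed

lemma C21_continuous:
  assumes "C21 u"
  shows "continuous_on UNIV (\<lambda>z. u (fst z) (snd z))"
    and "continuous_on UNIV (\<lambda>z. deriv (u (fst z)) (snd z))"
    and "continuous_on UNIV (\<lambda>z. partial i (\<lambda>y. u y (snd z)) (fst z))"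
    and "continuous_on UNIV (\<lambda>z. partial j (partial i (\<lambda>y. u y (snd z))) (fst z))"
  using assms by (simp_all add: C21_def case_prod_beta')

lemma shift_error_tendsto_0:
  fixes U :: "'a::euclidean_space \<Rightarrow> real"
  assumes p: "1 < p" and U: "\<And>z. 0 \<le> U z" "continuous_on UNIV U"
    and f: "continuous_on UNIV f" "\<And>z. 0 \<le> f z" "\<And>z. r < norm z \<Longrightarrow> f z = 0"
  shows "(\<lambda>n. \<integral>z. f z * ((U z + hstep n) powr p - U z powr p)\<^sup>2 \<partial>lborel) \<longlonglongrightarrow> 0"
proof -
  have cU: "continuous_on UNIV (\<lambda>z. (U z + e) powr p)" if "e \<ge> 0" for e
    using U p that by (intro continuous_on_powr' continuous_intros) (auto intro: add_nonneg_nonneg)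
  have cU0: "continuous_on UNIV (\<lambda>z. U z powr p)" using cU[of 0] by simp
  have h: "hstep n \<ge> 0" "hstep n \<le> 1" for n using hstep(2,4)[of n] by auto
  have "(\<lambda>n. \<integral>z. f z * ((U z + hstep n) powr p - U z powr p)\<^sup>2 \<partial>lborel) \<longlonglongrightarrow> (\<integral>z. 0 \<partial>(lborel :: 'a measure))"
  proof (rule integral_dominated_convergence[where w = "\<lambda>z. f z * ((U z + 1) powr p)\<^sup>2"])
    show "integrable lborel (\<lambda>z. f z * ((U z + 1) powr p)\<^sup>2)"
      by (rule integrable_bounded_support[of _ r]) (use f in \<open>auto intro!: continuous_intros cU\<close>)
    show "(\<lambda>z. f z * ((U z + hstep n) powr p - U z powr p)\<^sup>2) \<in> borel_measurable lborel" for n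
      using h(1)[of n] by (auto intro!: borel_measurable_continuous_onI continuous_intros f cU cU0)
    show "AE z in lborel. (\<lambda>n. f z * ((U z + hstep n) powr p - U z powr p)\<^sup>2) \<longlonglongrightarrow> 0"
    proof (rule AE_I2)
      fix z
      have 1: "(\<lambda>n. (U z + hstep n) powr p) \<longlonglongrightarrow> (U z + 0) powr p"
        using p U(1)[of z] h by (intro tendsto_powr' tendsto_intros hstep) auto
      have "(\<lambda>n. (U z + hstep n) powr p - U z powr p) \<longlonglongrightarrow> (U z + 0) powr p - U z powr p"
        by (intro tendsto_diff 1 tendsto_const)
      then have "(\<lambda>n. ((U z + hstep n) powr p - U z powr p)\<^sup>2) \<longlonglongrightarrow> ((U z + 0) powr p - U z powr p)\<^sup>2"
        by (rule tendsto_power)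
      then have "(\<lambda>n. f z * ((U z + hstep n) powr p - U z powr p)\<^sup>2) \<longlonglongrightarrow> f z * ((U z + 0) powr p - U z powr p)\<^sup>2"
        by (rule tendsto_mult_left)
      then show "(\<lambda>n. f z * ((U z + hstep n) powr p - U z powr p)\<^sup>2) \<longlonglongrightarrow> 0" by simp
    qed
    show "AE z in lborel. norm (f z * ((U z + hstep n) powr p - U z powr p)\<^sup>2) \<le> f z * ((U z + 1) powr p)\<^sup>2" for n
    proof (rule AE_I2)
      fix z
      have "U z powr p \<le> (U z + hstep n) powr p" "(U z + hstep n) powr p \<le> (U z + 1) powr p"
        using U(1)[of z] h[of n] p by (auto intro!: powr_mono2)
      then have "((U z + hstep n) powr p - U z powr p)\<^sup>2 \<le> ((U z + 1) powr p)\<^sup>2"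
        using powr_ge_zero[of "U z" p] by (intro power_mono) linarith+
      then show "norm (f z * ((U z + hstep n) powr p - U z powr p)\<^sup>2) \<le> f z * ((U z + 1) powr p)\<^sup>2"
        using f(2)[of z] by (simp add: mult_left_mono)
    qed
  qed auto
  then show ?thesis by simp
qed

text \<open>Adding a constant \<open>e\<close> to the solution leaves all derivatives unchanged, so
  only the power term needs a correction. The constant \<open>C\<close> is independent of
  \<open>e\<close>; with \<open>R\<close> fixed, letting \<open>e\<close> tend to 0 removes the
  correction.\<close>

lemma solution_energy_bound:
  fixes u :: "real^'n::finite \<Rightarrow> real \<Rightarrow> real"
  assumes sol: "nonneg_solution p (2 * p / (p + 1)) M u" and p: "1 < p" and R: "0 < R"
    and ab: "absorbing p \<alpha> \<nu> \<mu> \<kappa> \<epsilon> C cT cP cQ cY" and C: "0 \<le> C"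
    and \<nu>: "\<nu> = 1 - 1 / real CARD('n)" and \<mu>: "\<mu> = \<kappa> * (1 + 2 / real CARD('n))" and \<alpha>: "\<alpha> = \<kappa> - \<kappa>\<^sup>2 * \<nu>"
    and M: "0 < M" "M < \<epsilon>" and s: "4 * p / (p - 1) \<le> real (k + 3)"
  shows "(\<integral>z. profile R z ^ (k + 3) * (u (fst z) (snd z) powr p)\<^sup>2 \<partial>lborel)
    \<le> C * (((2 * real (k + 3) + real CARD('n)) / R) powr (4 * p / (p - 1)) * ((2 * R) ^ CARD('n) * (2 * R\<^sup>2)))"
proof -
  define U where "U z = u (fst z) (snd z)" for z
  define Z where "Z = ((2 * real (k + 3) + real CARD('n)) / R) powr (4 * p / (p - 1)) * ((2 * R) ^ CARD('n) * (2 * R\<^sup>2))"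
  have C21: "C21 u" and U0: "\<And>z. 0 \<le> U z" using sol by (auto simp: nonneg_solution_def U_def)
  have cU: "continuous_on UNIV U" using C21_continuous(1)[OF C21] by (simp add: U_def[abs_def])
  define f where "f z = profile R z ^ (k + 3)" for z :: "(real^'n) \<times> real"
  have f: "continuous_on UNIV f" "\<And>z. 0 \<le> f z" "\<And>z. R + R\<^sup>2 < norm z \<Longrightarrow> f z = 0"
    using profile_bounds(1)[OF R] profile_eq_0_outside[OF R]
    by (auto simp: f_def[abs_def] intro!: continuous_intros continuous_profile zero_le_power)
  have cp: "continuous_on UNIV (\<lambda>z. (U z + e) powr p)" if "e \<ge> 0" for e
    using U0 cU p that by (intro continuous_on_powr' continuous_intros) (auto intro: add_nonneg_nonneg)
  have cp0: "continuous_on UNIV (\<lambda>z. U z powr p)" using cp[of 0] by simp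
  have step: "(\<integral>z. f z * (U z powr p)\<^sup>2 \<partial>lborel)
      \<le> C * (Z + (\<integral>z. f z * ((U z + e) powr p - U z powr p)\<^sup>2 \<partial>lborel))" if e: "e > 0" for e
  proof -
    interpret positive_flow R k "TYPE('n)" "\<lambda>z. U z + e" "\<lambda>z. deriv (u (fst z)) (snd z)"
      "\<lambda>z. (U z + e) powr p - U z powr p" "\<lambda>i z. partial i (\<lambda>y. u y (snd z)) (fst z)"
      "\<lambda>i j z. partial j (partial i (\<lambda>y. u y (snd z))) (fst z)" p M
    proof unfold_locales
      fix z :: "(real^'n) \<times> real" and i j :: 'n
      show "0 < U z + e" using U0[of z] e by linarith
      show "has_dir_deriv (space_dir i) (\<lambda>z. U z + e) (\<lambda>z. partial i (\<lambda>y. u y (snd z)) (fst z))"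
        using has_dir_deriv_add[OF C21_imp_has_dir_deriv(1)[OF C21] has_dir_deriv_const] by (simp add: U_def)
      show "has_dir_deriv time_dir (\<lambda>z. U z + e) (\<lambda>z. deriv (u (fst z)) (snd z))"
        using has_dir_deriv_add[OF C21_imp_has_dir_deriv(3)[OF C21] has_dir_deriv_const] by (simp add: U_def)
      have "sqrt (\<Sum>i\<in>UNIV. (partial i (\<lambda>y. u y (snd z)) (fst z))\<^sup>2) = norm (grad (\<lambda>y. u y (snd z)) (fst z))"
        by (simp add: norm_vec_def L2_set_def grad_def)
      then show "deriv (u (fst z)) (snd z) - (\<Sum>i\<in>UNIV. partial i (partial i (\<lambda>y. u y (snd z))) (fst z))
        = (U z + e) powr p + M * sqrt (\<Sum>i\<in>UNIV. (partial i (\<lambda>y. u y (snd z)) (fst z))\<^sup>2) powr (2 * p / (p + 1))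
          - ((U z + e) powr p - U z powr p)"
        using sol by (simp add: nonneg_solution_def laplacian_def U_def)
    qed (use R p e cU in \<open>auto intro!: C21_imp_has_dir_deriv C21_continuous C21 continuous_intros cp cp0\<close>)
    have "integrable lborel (\<lambda>z. f z * (U z powr p)\<^sup>2)" "integrable lborel (\<lambda>z. f z * ((U z + e) powr p)\<^sup>2)"
      by (rule integrable_bounded_support[of _ "R + R\<^sup>2"]; use f e in \<open>auto intro!: continuous_intros cp cp0\<close>)+
    then have "(\<integral>z. f z * (U z powr p)\<^sup>2 \<partial>lborel) \<le> (\<integral>z. f z * ((U z + e) powr p)\<^sup>2 \<partial>lborel)"
      using e p U0 f(2) by (intro integral_mono mult_left_mono power_mono powr_mono2) auto
    also have "\<dots> \<le> C * (Z + (\<integral>z. f z * ((U z + e) powr p - U z powr p)\<^sup>2 \<partial>lborel))"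
      using energy_bound[OF ab C \<nu> \<mu> \<alpha> M] s unfolding \<phi>_def m_def f_def Z_def by simp
    finally show ?thesis .
  qed
  have "(\<lambda>n. C * (Z + (\<integral>z. f z * ((U z + hstep n) powr p - U z powr p)\<^sup>2 \<partial>lborel))) \<longlonglongrightarrow> C * (Z + 0)"
    by (intro tendsto_intros shift_error_tendsto_0[OF p U0 cU f])
  then have "(\<integral>z. f z * (U z powr p)\<^sup>2 \<partial>lborel) \<le> C * (Z + 0)"
    by (rule LIMSEQ_le_const) (use step hstep(2) in blast)
  then show ?thesis by (simp add: f_def U_def Z_def)
qed

text \<open>For large \<open>R\<close> the profile is at least 1/2 on a fixed ball where
  \<open>F\<close> exceeds half of \<open>F z0\<close>. The bound is uniform in \<open>R\<close> and
  so contradicts the decay of the energy.\<close>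

lemma profile_integral_lower_bound:
  fixes F :: "(real^'n::finite) \<times> real \<Rightarrow> real"
  assumes F: "continuous_on UNIV F" "\<And>z. 0 \<le> F z" and z0: "0 < F z0"
  obtains c R0 where "0 < c" "0 < R0" "\<And>R. R0 \<le> R \<Longrightarrow> c \<le> (\<integral>z. profile R z ^ (k + 3) * F z \<partial>lborel)"
proof -
  obtain \<delta> where \<delta>: "\<delta> > 0" "\<And>z. dist z z0 < \<delta> \<Longrightarrow> dist (F z) (F z0) < F z0 / 2"
    using F(1) z0 unfolding continuous_on_iff by (metis UNIV_I half_gt_zero)
  define S where "S = ball z0 \<delta>"
  have S: "emeasure lborel S < \<infinity>" "S \<in> sets lborel" by (auto simp: S_def emeasure_lborel_ball_finite[unfolded infinity_ennreal_def])
  have FS: "F z0 / 2 \<le> F z" if "z \<in> S" for z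
  proof -
    have "\<bar>F z - F z0\<bar> < F z0 / 2" using \<delta>(2)[of z] that by (simp add: S_def dist_real_def dist_commute)
    then show ?thesis using abs_ge_minus_self[of "F z - F z0"] by linarith
  qed
  define \<rho> where "\<rho> = norm z0 + \<delta>"
  define c where "c = (1 / 2) ^ (k + 3) * (F z0 / 2) * measure lborel S"
  have "c > 0" unfolding c_def S_def using \<delta>(1) z0 by (intro mult_pos_pos content_ball_pos) auto
  \<comment> \<open>\<open>R\<close> exceeds twice \<rho>, so the spatial term of
    \<open>barrier\<close> is at most 1/4; \<open>R \<ge> 1\<close> gives
    \<open>R^2 \<le> R^4\<close>, hence the same for the time term.\<close>
  moreover have "c \<le> (\<integral>z. profile R z ^ (k + 3) * F z \<partial>lborel)" if R: "2 * (\<rho> + 1) \<le> R" for R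
  proof -
    have \<rho>: "\<rho> > 0" using \<delta>(1) by (simp add: \<rho>_def add_nonneg_pos)
    have R0: "R > 0" "R \<ge> 1" using R \<rho> by auto
    have prof: "1 / 2 \<le> profile R z" if "z \<in> S" for z
    proof -
      have "norm z \<le> \<rho>"
        using that norm_triangle_sub[of z z0] by (simp add: S_def \<rho>_def dist_norm norm_minus_commute)
      then have 1: "norm (fst z) \<le> \<rho>" "\<bar>snd z\<bar> \<le> \<rho>"
        using norm_fst_le[of "fst z" "snd z"] norm_snd_le[of "snd z" "fst z"] by auto
      have "fst z \<bullet> fst z \<le> \<rho>\<^sup>2" using 1(1) \<rho> by (simp add: power2_norm_eq_inner[symmetric] power_mono)
      moreover have "4 * \<rho>\<^sup>2 \<le> R\<^sup>2"
        using power_mono[of "2 * \<rho>" R 2] R \<rho> by (simp add: power_mult_distrib)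
      ultimately have "fst z \<bullet> fst z / R\<^sup>2 \<le> 1 / 4" using R0 by (simp add: pos_divide_le_eq)
      moreover have "(snd z)\<^sup>2 / R ^ 4 \<le> 1 / 4"
      proof -
        have "(snd z)\<^sup>2 \<le> \<rho>\<^sup>2" using 1(2) \<rho> by (simp add: power2_le_iff_abs_le)
        moreover have "R\<^sup>2 \<le> R ^ 4" using R0 by (intro power_increasing) auto
        ultimately have "4 * (snd z)\<^sup>2 \<le> R ^ 4" using \<open>4 * \<rho>\<^sup>2 \<le> R\<^sup>2\<close> by linarith
        then show ?thesis using R0 by (simp add: pos_divide_le_eq)
      qed
      ultimately show ?thesis unfolding profile_def barrier_def by linarith
    qed
    have int: "integrable lborel (\<lambda>z. profile R z ^ (k + 3) * F z)"
      by (rule integrable_bounded_support[of _ "R + R\<^sup>2"])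
         (use profile_eq_0_outside[OF R0(1)] in \<open>auto intro!: continuous_intros continuous_profile F\<close>)
    have i: "has_bochner_integral lborel (\<lambda>z. indicator S z *\<^sub>R ((1 / 2) ^ (k + 3) * (F z0 / 2)))
        (measure lborel S *\<^sub>R ((1 / 2) ^ (k + 3) * (F z0 / 2)))"
      using S by (intro has_bochner_integral_indicator) auto
    have le: "indicator S z *\<^sub>R ((1 / 2) ^ (k + 3) * (F z0 / 2)) \<le> profile R z ^ (k + 3) * F z" for z
    proof (cases "z \<in> S")
      case True
      have "(1 / 2) ^ (k + 3) * (F z0 / 2) \<le> profile R z ^ (k + 3) * F z"
        using prof[OF True] FS[OF True] z0 profile_bounds(1)[OF R0(1), of z] by (intro mult_mono power_mono) auto
      then show ?thesis using True by simp
    next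
      case False
      then show ?thesis using F(2)[of z] profile_bounds(1)[OF R0(1), of z] by simp
    qed
    have "(\<integral>z. indicator S z *\<^sub>R ((1 / 2) ^ (k + 3) * (F z0 / 2)) \<partial>lborel) \<le> (\<integral>z. profile R z ^ (k + 3) * F z \<partial>lborel)"
      by (rule integral_mono[OF integrable.intros[OF i] int le])
    then have "measure lborel S *\<^sub>R ((1 / 2) ^ (k + 3) * (F z0 / 2)) \<le> (\<integral>z. profile R z ^ (k + 3) * F z \<partial>lborel)"
      by (simp only: has_bochner_integral_integral_eq[OF i])
    then show ?thesis by (simp add: c_def mult_ac)
  qed
  moreover have "2 * (\<rho> + 1) > 0" using \<delta>(1) by (simp add: \<rho>_def add_nonneg_pos)
  ultimately show ?thesis using that by blast
qed

theorem theorem1p8: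
  fixes p q :: real
  assumes "1 < p" and "ereal p < p_B CARD('n::finite)" and "q = 2 * p / (p + 1)"
  shows "\<exists>\<epsilon>\<^sub>0>0. \<forall>M. 0 < M \<and> M < \<epsilon>\<^sub>0 \<longrightarrow>
           (\<forall>u :: real^'n \<Rightarrow> real \<Rightarrow> real. nonneg_solution p q M u \<longrightarrow> (\<forall>x t. u x t = 0))"
proof -
  define N where "N = CARD('n)"
  define s where "s = 4 * p / (p - 1)"
  have N: "1 \<le> N" by (simp add: N_def Suc_le_eq)
  obtain \<kappa> where \<kappa>: "0 < \<kappa>" "\<kappa> * (1 - 1 / real N) < 1" "(1 - 1 / real N) * p < \<kappa> * (1 + 2 / real N)"
    using kappa_exists[OF assms(1) assms(2)[folded N_def] N] by blast
  define \<nu> where "\<nu> = 1 - 1 / real N"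
  define \<mu> where "\<mu> = \<kappa> * (1 + 2 / real N)"
  define \<alpha> where "\<alpha> = \<kappa> - \<kappa>\<^sup>2 * \<nu>"
  have "\<alpha> = \<kappa> * (1 - \<kappa> * \<nu>)" by (simp add: \<alpha>_def power2_eq_square algebra_simps)
  then have \<alpha>: "0 < \<alpha>" using \<kappa>(1,2) by (simp add: \<nu>_def)
  have \<nu>: "0 \<le> \<nu>" "\<nu> \<le> 1" using N by (auto simp: \<nu>_def)
  have \<mu>: "\<nu> * p < \<mu>" using \<kappa>(3) by (simp add: \<nu>_def \<mu>_def)
  obtain \<epsilon> C cT cP cQ cY where \<epsilon>: "\<epsilon> > 0" and C: "0 \<le> C" and ab: "absorbing p \<alpha> \<nu> \<mu> \<kappa> \<epsilon> C cT cP cQ cY"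
    using absorbing_exists[OF assms(1) \<alpha> \<nu> \<mu>, of \<kappa>] \<kappa>(1) by auto
  \<comment> \<open>Makes the cutoff exponent \<open>k + 3\<close> at least \<open>s\<close>, so
    that the weight compensates the singular powers of \<open>scale\<close>.\<close>
  define k where "k = nat \<lceil>s\<rceil>"
  have k: "s \<le> real (k + 3)" unfolding k_def by linarith
  \<comment> \<open>Independent of \<open>u\<close>, \<open>M\<close> and \<open>R\<close>: the
    power \<open>R powr (N + 2 - s)\<close>, from the box volume and
    \<open>scaled_power_bound\<close>, is split off.\<close>
  define A where "A = C * ((2 * real (k + 3) + real N) powr s * (2 ^ N * 2))"
  have bound: "(\<integral>z. profile R z ^ (k + 3) * (u (fst z) (snd z) powr p)\<^sup>2 \<partial>lborel) \<le> A * R powr (real N + 2 - s)"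
    if "nonneg_solution p q M u" "0 < M" "M < \<epsilon>" "0 < R" for M R and u :: "real^'n \<Rightarrow> real \<Rightarrow> real"
  proof -
    have "(\<integral>z. profile R z ^ (k + 3) * (u (fst z) (snd z) powr p)\<^sup>2 \<partial>lborel)
      \<le> C * (((2 * real (k + 3) + real N) / R) powr s * ((2 * R) ^ N * (2 * R\<^sup>2)))"
      unfolding N_def s_def
      by (rule solution_energy_bound[OF that(1)[unfolded assms(3)] assms(1) that(4) ab C])
         (use that k in \<open>simp_all add: \<nu>_def \<mu>_def \<alpha>_def N_def s_def\<close>)
    also have "((2 * real (k + 3) + real N) / R) powr s * ((2 * R) ^ N * (2 * R\<^sup>2))
      = (2 * real (k + 3) + real N) powr s * (2 ^ N * 2) * (R ^ N * R\<^sup>2 / R powr s)"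
      using that(4) by (simp add: powr_divide power_mult_distrib)
    also have "R ^ N * R\<^sup>2 / R powr s = R powr (real N + 2 - s)"
      using that(4) by (simp add: powr_diff powr_add powr_realpow)
    finally show ?thesis by (simp add: A_def mult_ac)
  qed
  have "((\<lambda>R. A * R powr (real N + 2 - s)) \<longlongrightarrow> A * 0) at_top"
    using decay_exponent_neg[OF assms(1) assms(2)[folded N_def] N]
    by (intro tendsto_mult tendsto_const tendsto_neg_powr filterlim_ident) (simp add: s_def)
  then have lim: "((\<lambda>R. A * R powr (real N + 2 - s)) \<longlongrightarrow> 0) at_top" by simp
  have "u x t = 0" if sol: "nonneg_solution p q M u" and M: "0 < M" "M < \<epsilon>" for M x t and u :: "real^'n \<Rightarrow> real \<Rightarrow> real"
  proof (rule ccontr)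
    assume ne: "u x t \<noteq> 0"
    define F where "F z = (u (fst z) (snd z) powr p)\<^sup>2" for z
    have u: "C21 u" "\<And>x t. 0 \<le> u x t" using sol by (auto simp: nonneg_solution_def)
    have "continuous_on UNIV F" unfolding F_def[abs_def]
      using u(2) assms(1) by (intro continuous_on_powr' continuous_intros C21_continuous u) auto
    moreover have "0 < F (x, t)" using ne by (simp add: F_def)
    ultimately obtain c R0 where c: "0 < c" "0 < R0" "\<And>R. R0 \<le> R \<Longrightarrow> c \<le> (\<integral>z. profile R z ^ (k + 3) * F z \<partial>lborel)"
      using profile_integral_lower_bound[of F "(x, t)" k] by (auto simp: F_def)
    have "eventually (\<lambda>R. A * R powr (real N + 2 - s) < c) at_top"
      using lim c(1) by (rule order_tendstoD)
    then have "eventually (\<lambda>R. A * R powr (real N + 2 - s) < c \<and> R0 \<le> R) at_top"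
      using eventually_ge_at_top by (rule eventually_conj)
    then obtain R where "A * R powr (real N + 2 - s) < c" "R0 \<le> R"
      by (auto dest: eventually_happens)
    then show False using bound[OF sol M, of R] c(3)[of R] c(2) by (simp add: F_def)
  qed
  then show ?thesis using \<epsilon> by blast
qed

end
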